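(* There is a constant $d_0>0$ such that for every integer $d\geq d_0$ and every even integer $L\geq 4$, the Glauber dynamics chain $\mathcal{M}_3$ on the set $\mathcal{C}_3(T_{L,d})$ of proper $3$-colorings of the discrete torus $T_{L,d}$ satisfies $$\tau_{\mathcal{M}_3} \geq \exp\left\{\frac{L^{d-1}}{d^4\log^2 L}\right\}.$$
   Context: $T_{L,d}$ (with $L$ even) is the graph on vertex set $V=\{0,\ldots,L-1\}^d$ whose edges are the pairs of vertices that differ on exactly one coordinate and differ by $1$ (mod $L$) on that coordinate. $\mathcal{C}_3=\mathcal{C}_3(T_{L,d})$ is the set of proper $3$-colorings $\chi:V\to\{0,1,2\}$ (adjacent vertices receive different colors). The chain $\mathcal{M}_3$ is the Markov chain on state space $\mathcal{C}_3$ with transition probabilities $P_3(\chi_1,\chi_2)=0$ if $|\{v\in V:\chi_1(v)\neq\chi_2(v)\}|>1$; $P_3(\chi_1,\chi_2)=\frac{1}{3|V|}$ if $|\{v\in V:\chi_1(v)\neq\chi_2(v)\}|=1$; and $P_3(\chi_1,\chi_1)=1-\sum_{\chi_2'\in\mathcal{C}_3,\ \chi_2'\neq\chi_1}P_3(\chi_1,\chi_2')$. For a Markov chain $\mathcal{M}$ on a finite state space $\Omega$ with uniform stationary distribution $\pi$, let $P^t(X,\cdot)$ be the distribution at time $t$ when started at $X$. The mixing time is $$\tau_{\mathcal{M}}=\min\left\{t_0:\ \|P^t,\pi\|_{\mathrm{tv}}\leq \tfrac1e\ \text{ for all } t>t_0\right\},\qquad \|P^t,\pi\|_{\mathrm{tv}}=\max_{X\in\Omega}\frac12\sum_{Y\in\Omega}|P^t(X,Y)-\pi(Y)|,$$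 with $\tau_{\mathcal{M}}=+\infty$ if no such $t_0$ exists; for $\mathcal{M}_3$, $\pi$ is the uniform distribution on $\mathcal{C}_3$. Logarithms are to base $2$. *)

theory Defs
  imports Complex_Main "HOL-Library.FuncSet" "HOL-Library.Extended_Real" "HOL-Number_Theory.Cong"
begin

text \<open>
  Vertices and colorings are extensional functions (\<open>undefined\<close> outside their domain), so that
  equality of functions is equality on the domain and the sets below are finite with the
  expected cardinalities.
\<close>

definition torus_verts :: "nat \<Rightarrow> nat \<Rightarrow> (nat \<Rightarrow> nat) set" where
  "torus_verts L d = {..<d} \<rightarrow>\<^sub>E {..<L}"

definition torus_adj :: "nat \<Rightarrow> nat \<Rightarrow> (nat \<Rightarrow> nat) \<Rightarrow> (nat \<Rightarrow> nat) \<Rightarrow> bool" where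
  "torus_adj L d u v \<longleftrightarrow>
     u \<in> torus_verts L d \<and> v \<in> torus_verts L d \<and>
     (\<exists>i<d. {j. j < d \<and> u j \<noteq> v j} = {i} \<and>
            ([u i = v i + 1] (mod L) \<or> [v i = u i + 1] (mod L)))"

definition proper_colorings :: "'v set \<Rightarrow> ('v \<Rightarrow> 'v \<Rightarrow> bool) \<Rightarrow> nat \<Rightarrow> ('v \<Rightarrow> nat) set" where
  "proper_colorings V adj q =
     {\<chi> \<in> V \<rightarrow>\<^sub>E {..<q}. \<forall>u\<in>V. \<forall>v\<in>V. adj u v \<longrightarrow> \<chi> u \<noteq> \<chi> v}"

definition C3 :: "nat \<Rightarrow> nat \<Rightarrow> ((nat \<Rightarrow> nat) \<Rightarrow> nat) set" where
  "C3 L d = proper_colorings (torus_verts L d) (torus_adj L d) 3"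

definition num_diff :: "'v set \<Rightarrow> ('v \<Rightarrow> 'c) \<Rightarrow> ('v \<Rightarrow> 'c) \<Rightarrow> nat" where
  "num_diff V \<chi>1 \<chi>2 = card {v \<in> V. \<chi>1 v \<noteq> \<chi>2 v}"

definition P3_off :: "nat \<Rightarrow> nat \<Rightarrow> ((nat \<Rightarrow> nat) \<Rightarrow> nat) \<Rightarrow> ((nat \<Rightarrow> nat) \<Rightarrow> nat) \<Rightarrow> real" where
  "P3_off L d \<chi>1 \<chi>2 =
     (if num_diff (torus_verts L d) \<chi>1 \<chi>2 = 1
      then 1 / (3 * real (card (torus_verts L d))) else 0)"

text \<open>Only the values of \<open>P3\<close> on pairs of elements of \<open>C3 L d\<close> are meaningful.\<close>

definition P3 :: "nat \<Rightarrow> nat \<Rightarrow> ((nat \<Rightarrow> nat) \<Rightarrow> nat) \<Rightarrow> ((nat \<Rightarrow> nat) \<Rightarrow> nat) \<Rightarrow> real" where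
  "P3 L d \<chi>1 \<chi>2 =
     (if \<chi>1 = \<chi>2 then 1 - (\<Sum>\<chi>'\<in>C3 L d - {\<chi>1}. P3_off L d \<chi>1 \<chi>')
      else P3_off L d \<chi>1 \<chi>2)"

primrec kernel_power :: "'s set \<Rightarrow> ('s \<Rightarrow> 's \<Rightarrow> real) \<Rightarrow> nat \<Rightarrow> 's \<Rightarrow> 's \<Rightarrow> real" where
  "kernel_power \<Omega> P 0 X Y = (if X = Y then 1 else 0)"
| "kernel_power \<Omega> P (Suc t) X Y = (\<Sum>Z\<in>\<Omega>. kernel_power \<Omega> P t X Z * P Z Y)"

definition uniform_dist :: "'s set \<Rightarrow> 's \<Rightarrow> real" where
  "uniform_dist \<Omega> X = (if X \<in> \<Omega> then 1 / real (card \<Omega>) else 0)"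

text \<open>For finite nonempty \<open>\<Omega>\<close>.\<close>

definition tv_dist :: "'s set \<Rightarrow> ('s \<Rightarrow> 's \<Rightarrow> real) \<Rightarrow> ('s \<Rightarrow> real) \<Rightarrow> real" where
  "tv_dist \<Omega> Q \<pi> = Max ((\<lambda>X. 1/2 * (\<Sum>Y\<in>\<Omega>. \<bar>Q X Y - \<pi> Y\<bar>)) ` \<Omega>)"

definition mixed_after :: "'s set \<Rightarrow> ('s \<Rightarrow> 's \<Rightarrow> real) \<Rightarrow> nat \<Rightarrow> bool" where
  "mixed_after \<Omega> P t\<^sub>0 \<longleftrightarrow>
     (\<forall>t>t\<^sub>0. tv_dist \<Omega> (kernel_power \<Omega> P t) (uniform_dist \<Omega>) \<le> 1 / exp 1)"

definition mixing_time :: "'s set \<Rightarrow> ('s \<Rightarrow> 's \<Rightarrow> real) \<Rightarrow> enat" where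
  "mixing_time \<Omega> P =
     (if \<exists>t\<^sub>0. mixed_after \<Omega> P t\<^sub>0 then enat (LEAST t\<^sub>0. mixed_after \<Omega> P t\<^sub>0) else \<infinity>)"

end

theory Submission
  imports Defs "HOL-Real_Asymp.Real_Asymp"
begin

text \<open>
  For \<open>L \<ge> 6\<close> the chain is not even connected: a vertex changes its color only while all its
  neighbors share the third color, so the winding number of the coloring, read modulo 3, along a
  coordinate line is invariant, and there are colorings of positive winding number. Exchanging two
  colors negates the winding number, so these colorings form a closed class containing at most half
  of all states, and the mixing time is infinite.

  For \<open>L = 4\<close> the torus is the hypercube \<open>Q\<^sub>n\<close> with \<open>n = 2d\<close>. Give an even vertex the type \<open>T\<^sub>u\<close>,
  the set of colors on its neighborhood. The colorings in which more than half of the even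
  vertices have type \<open>{0}\<close> make up at most half of all colorings, but they include the \<open>2\<^bsup>|E|\<^esup>\<close>
  colorings that are 0 on all odd vertices (\<open>E\<close> is the set of even vertices). They can only be
  left through the colorings in which the number of vertices of type \<open>{0}\<close> is between \<open>|E|/2\<close> and
  \<open>|E|/2 + n\<close>. There are at most \<open>2\<^bsup>|E|\<^esup> exp (- |E| / (20 n))\<close> of the latter, by an entropy
  argument: apply Shearer's inequality to the blocks \<open>{w} \<union> {w + e\<^sub>i + e\<^sub>j}\<close> around the odd
  vertices \<open>w\<close>. Given the types of the neighbors of \<open>w\<close>, the vertex \<open>w + e\<^sub>i + e\<^sub>j\<close> has two
  possible colors only if \<open>w + e\<^sub>i\<close> and \<open>w + e\<^sub>j\<close> have the same two-element type, so every pair of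
  distinct types costs half a bit; describing the types costs only \<open>O(ln n / n)\<close> per such pair,
  and isoperimetry makes such pairs abundant.
\<close>

section \<open>Mixing time and bottlenecks\<close>

text \<open>A set of stationary mass at most 1/2 then holds less than 1/2 + 2/5 = 9/10 once the
  chain has mixed.\<close>

lemma exp_1_gt: "1 / exp 1 < (2/5 :: real)"
proof -
  have "(5/2::real) < exp 1"
  proof -
    \<comment> \<open>At 1 itself the quadratic Taylor bound only gives
      \<open>5/2 \<le> exp 1\<close>; taken at 1/4 and raised to the fourth power it becomes
      strict.\<close>
    have "(1 + (1/4::real) + (1/4)^2/2) ^ 4 \<le> exp (1/4) ^ 4"
      by (intro power_mono exp_lower_Taylor_quadratic) auto
    also have "\<dots> = exp (1::real)" by (simp flip: exp_of_nat_mult)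
    finally show ?thesis by (simp add: power4_eq_xxxx power2_eq_square)
  qed
  thus ?thesis by (simp add: field_simps)
qed

locale symmetric_chain =
  fixes \<Omega> :: "'s set" and P :: "'s \<Rightarrow> 's \<Rightarrow> real"
  assumes finite_states: "finite \<Omega>"
    and nonneg: "\<And>X Y. X \<in> \<Omega> \<Longrightarrow> Y \<in> \<Omega> \<Longrightarrow> P X Y \<ge> 0"
    and row_sum: "\<And>X. X \<in> \<Omega> \<Longrightarrow> (\<Sum>Y\<in>\<Omega>. P X Y) = 1"
    and sym: "\<And>X Y. X \<in> \<Omega> \<Longrightarrow> Y \<in> \<Omega> \<Longrightarrow> P X Y = P Y X"
begin

lemma kernel_power_nonneg:
  "X \<in> \<Omega> \<Longrightarrow> Y \<in> \<Omega> \<Longrightarrow> kernel_power \<Omega> P t X Y \<ge> 0"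
  by (induction t arbitrary: Y) (auto intro!: sum_nonneg mult_nonneg_nonneg nonneg)

lemma kernel_power_row_sum:
  "X \<in> \<Omega> \<Longrightarrow> (\<Sum>Y\<in>\<Omega>. kernel_power \<Omega> P t X Y) = 1"
proof (induction t)
  case 0
  thus ?case using finite_states by simp
next
  case (Suc t)
  have "(\<Sum>Y\<in>\<Omega>. kernel_power \<Omega> P (Suc t) X Y)
      = (\<Sum>Z\<in>\<Omega>. kernel_power \<Omega> P t X Z * (\<Sum>Y\<in>\<Omega>. P Z Y))"
    by (simp add: sum_distrib_left) (rule sum.swap)
  thus ?case using Suc by (simp add: row_sum)
qed

text \<open>Unnormalized: every state of \<open>A\<close> starts with one unit, so this is
  \<open>card A\<close> times the law of the chain started uniformly on \<open>A\<close>.\<close>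

definition mass :: "'s set \<Rightarrow> nat \<Rightarrow> 's \<Rightarrow> real" where
  "mass A t Y = (\<Sum>X\<in>A. kernel_power \<Omega> P t X Y)"

lemma mass_Suc: "mass A (Suc t) Y = (\<Sum>Z\<in>\<Omega>. mass A t Z * P Z Y)"
  unfolding mass_def by (simp add: sum_distrib_right) (rule sum.swap)

lemma mass_nonneg: "A \<subseteq> \<Omega> \<Longrightarrow> Y \<in> \<Omega> \<Longrightarrow> mass A t Y \<ge> 0"
  unfolding mass_def by (intro sum_nonneg kernel_power_nonneg) auto

text \<open>By symmetry of \<open>P\<close> the columns sum to 1 as well, so no state ever carries more than the
  unit mass it may have started with.\<close>

lemma mass_le_1:
  assumes "A \<subseteq> \<Omega>" "Y \<in> \<Omega>"
  shows "mass A t Y \<le> 1"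
  using assms(2)
proof (induction t arbitrary: Y)
  case 0
  have "finite A" using assms(1) finite_states finite_subset by blast
  thus ?case by (simp add: mass_def)
next
  case (Suc t)
  have "mass A (Suc t) Y \<le> (\<Sum>Z\<in>\<Omega>. 1 * P Z Y)"
    unfolding mass_Suc using Suc by (intro sum_mono mult_right_mono nonneg) auto
  also have "\<dots> = (\<Sum>Z\<in>\<Omega>. P Y Z)" using Suc.prems by (simp add: sym)
  finally show ?case using Suc.prems by (simp add: row_sum)
qed

text \<open>Mass leaves \<open>A\<close> only from \<open>B\<close>, and by \<open>mass_le_1\<close>
  the states of \<open>B\<close> together never hold more than \<open>card B\<close>, so each step
  loses at most that much.\<close>

lemma retained_mass:
  assumes A: "A \<subseteq> \<Omega>" and B: "B \<subseteq> A"
    and exits: "\<And>Z Y. Z \<in> A - B \<Longrightarrow> Y \<in> \<Omega> - A \<Longrightarrow> P Z Y = 0"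
  shows "(\<Sum>Y\<in>A. mass A t Y) \<ge> real (card A) - real t * real (card B)"
proof (induction t)
  case 0
  have "finite A" using A finite_states finite_subset by blast
  thus ?case by (simp add: mass_def)
next
  case (Suc t)
  have fA: "finite A" using A finite_states finite_subset by blast
  have stay: "(\<Sum>Y\<in>A. P Z Y) = 1" if "Z \<in> A - B" for Z
  proof -
    have "(\<Sum>Y\<in>A. P Z Y) = (\<Sum>Y\<in>\<Omega>. P Z Y)"
      using A exits[OF that] by (intro sum.mono_neutral_left finite_states) auto
    thus ?thesis using that A row_sum by auto
  qed
  have "(\<Sum>Y\<in>A. mass A t Y) = (\<Sum>Y\<in>A - B. mass A t Y) + (\<Sum>Y\<in>B. mass A t Y)"
    using fA B by (simp add: sum.subset_diff)
  also have "(\<Sum>Y\<in>B. mass A t Y) \<le> (\<Sum>Y\<in>B. 1)"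
    using A B by (intro sum_mono mass_le_1) auto
  also have "(\<Sum>Z\<in>A - B. mass A t Z) = (\<Sum>Z\<in>A - B. mass A t Z * (\<Sum>Y\<in>A. P Z Y))"
    by (simp add: stay)
  also have "\<dots> \<le> (\<Sum>Z\<in>\<Omega>. mass A t Z * (\<Sum>Y\<in>A. P Z Y))"
    using A B by (intro sum_mono2 finite_states mult_nonneg_nonneg mass_nonneg sum_nonneg nonneg)
      auto
  also have "\<dots> = (\<Sum>Y\<in>A. mass A (Suc t) Y)"
    unfolding mass_Suc by (simp add: sum_distrib_left) (rule sum.swap)
  finally have "(\<Sum>Y\<in>A. mass A t Y) \<le> (\<Sum>Y\<in>A. mass A (Suc t) Y) + real (card B)"
    by simp
  with Suc show ?case by (simp add: algebra_simps)
qed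

text \<open>The positive and negative parts of a difference of two distributions have the same
  total, so half the L1 norm dominates the excess on any event.\<close>

lemma tv_dist_ge:
  assumes X: "X \<in> \<Omega>" and A: "A \<subseteq> \<Omega>"
  shows "tv_dist \<Omega> (kernel_power \<Omega> P t) (uniform_dist \<Omega>)
    \<ge> (\<Sum>Y\<in>A. kernel_power \<Omega> P t X Y) - real (card A) / real (card \<Omega>)"
proof -
  let ?f = "\<lambda>Y. kernel_power \<Omega> P t X Y - uniform_dist \<Omega> Y"
  have ne: "\<Omega> \<noteq> {}" using X by auto
  have "(\<Sum>Y\<in>\<Omega>. uniform_dist \<Omega> Y) = 1"
    using ne finite_states by (simp add: uniform_dist_def)
  hence "(\<Sum>Y\<in>\<Omega>. ?f Y) = 0"
    using kernel_power_row_sum[OF X] by (simp add: sum_subtractf)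
  moreover have "(\<Sum>Y\<in>\<Omega>. ?f Y) = (\<Sum>Y\<in>\<Omega> - A. ?f Y) + (\<Sum>Y\<in>A. ?f Y)"
    using A finite_states by (rule sum.subset_diff)
  moreover have "(\<Sum>Y\<in>\<Omega>. \<bar>?f Y\<bar>) = (\<Sum>Y\<in>\<Omega> - A. \<bar>?f Y\<bar>) + (\<Sum>Y\<in>A. \<bar>?f Y\<bar>)"
    using A finite_states by (rule sum.subset_diff)
  moreover have "(\<Sum>Y\<in>A. ?f Y) \<le> (\<Sum>Y\<in>A. \<bar>?f Y\<bar>)" by (intro sum_mono) auto
  moreover have "- (\<Sum>Y\<in>\<Omega> - A. ?f Y) \<le> (\<Sum>Y\<in>\<Omega> - A. \<bar>?f Y\<bar>)"
    by (simp flip: sum_negf) (intro sum_mono, auto)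
  ultimately have "(\<Sum>Y\<in>A. ?f Y) \<le> 1/2 * (\<Sum>Y\<in>\<Omega>. \<bar>?f Y\<bar>)" by simp
  also have "\<dots> \<le> tv_dist \<Omega> (kernel_power \<Omega> P t) (uniform_dist \<Omega>)"
    unfolding tv_dist_def using X finite_states by (intro Max_ge) auto
  finally have "(\<Sum>Y\<in>A. ?f Y) \<le> tv_dist \<Omega> (kernel_power \<Omega> P t) (uniform_dist \<Omega>)" .
  moreover have "(\<Sum>Y\<in>A. uniform_dist \<Omega> Y) = real (card A) / real (card \<Omega>)"
  proof -
    have "(\<Sum>Y\<in>A. uniform_dist \<Omega> Y) = (\<Sum>Y\<in>A. 1 / real (card \<Omega>))"
      using A by (intro sum.cong) (auto simp: uniform_dist_def)
    thus ?thesis by simp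
  qed
  ultimately show ?thesis by (simp add: sum_subtractf)
qed

text \<open>A bottleneck bound: averaged over starts in \<open>A\<close>, the mass in
  \<open>A\<close> at time \<open>m + 1\<close> is below 9/10 if the chain has mixed, but
  \<open>retained_mass\<close> keeps it at least \<open>1 - (m + 1) * card B / card A\<close>. With
  \<open>B\<close> empty every \<open>K\<close> satisfies \<open>ratio\<close>, and the mixing time
  is infinite.\<close>

lemma mixing_time_ge:
  assumes A: "A \<subseteq> \<Omega>" "A \<noteq> {}" and half: "2 * card A \<le> card \<Omega>" and B: "B \<subseteq> A"
    and exits: "\<And>Z Y. Z \<in> A - B \<Longrightarrow> Y \<in> \<Omega> - A \<Longrightarrow> P Z Y = 0"
    and ratio: "10 * (K + 1) * real (card B) \<le> real (card A)"
  shows "ereal K \<le> ereal_of_enat (mixing_time \<Omega> P)"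
proof (cases "\<exists>t\<^sub>0. mixed_after \<Omega> P t\<^sub>0")
  case False
  thus ?thesis by (simp add: mixing_time_def)
next
  case True
  define m where "m = (LEAST t\<^sub>0. mixed_after \<Omega> P t\<^sub>0)"
  have fA: "finite A" using A finite_states finite_subset by blast
  have cA: "real (card A) > 0" using fA A by (simp add: card_gt_0_iff)
  have "mixed_after \<Omega> P m" unfolding m_def using True by (rule LeastI_ex)
  \<comment> \<open>\<open>mixed_after\<close> speaks of times strictly after \<open>m\<close>,
    hence \<open>Suc m\<close>.\<close>
  hence tv: "tv_dist \<Omega> (kernel_power \<Omega> P (Suc m)) (uniform_dist \<Omega>) \<le> 1 / exp 1"
    unfolding mixed_after_def by blast
  have less: "(\<Sum>Y\<in>A. kernel_power \<Omega> P (Suc m) X Y) < 9/10" if "X \<in> A" for X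
  proof -
    have "card A > 0" "card \<Omega> > 0" using cA half by auto
    hence "real (card A) / real (card \<Omega>) \<le> 1/2" using half by (simp add: field_simps)
    thus ?thesis using tv_dist_ge[of X A "Suc m"] that A tv exp_1_gt by fastforce
  qed
  have "real (card A) - real (Suc m) * real (card B) \<le> (\<Sum>Y\<in>A. mass A (Suc m) Y)"
    using retained_mass[OF A(1) B exits] by blast
  also have "\<dots> = (\<Sum>X\<in>A. \<Sum>Y\<in>A. kernel_power \<Omega> P (Suc m) X Y)"
    unfolding mass_def by (rule sum.swap)
  also have "\<dots> < (\<Sum>X\<in>A. 9/10)"
    using A fA less by (intro sum_strict_mono) auto
  finally have "real (card A) < 10 * (real m + 1) * real (card B)" by (simp add: algebra_simps)
  with ratio have "(K + 1) * real (card B) < (real m + 1) * real (card B)" by linarith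
  hence "K < real m" by (simp add: mult_less_cancel_right)
  moreover have "mixing_time \<Omega> P = enat m" using True by (simp add: mixing_time_def m_def)
  ultimately show ?thesis by simp
qed

end


section \<open>The Glauber dynamics on 3-colorings as a symmetric chain\<close>

lemma finite_torus_verts: "finite (torus_verts L d)"
  unfolding torus_verts_def by (intro finite_PiE) auto

lemma finite_C3: "finite (C3 L d)"
  unfolding C3_def proper_colorings_def
  by (rule finite_subset[of _ "torus_verts L d \<rightarrow>\<^sub>E {..<3}"])
     (auto intro!: finite_PiE finite_torus_verts)

lemma num_diff_sym: "num_diff V \<chi> \<chi>' = num_diff V \<chi>' \<chi>"
  unfolding num_diff_def by metis

lemma C3_PiE: "\<chi> \<in> C3 L d \<Longrightarrow> \<chi> \<in> torus_verts L d \<rightarrow>\<^sub>E {..<3}"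
  unfolding C3_def proper_colorings_def by blast

lemma num_diff_1_obtain:
  assumes "num_diff V \<chi> \<chi>' = 1" "\<chi> \<in> V \<rightarrow>\<^sub>E A" "\<chi>' \<in> V \<rightarrow>\<^sub>E A"
  obtains v where "v \<in> V" "\<chi> v \<noteq> \<chi>' v" "\<chi>' = \<chi>(v := \<chi>' v)"
proof -
  obtain v where v: "{v \<in> V. \<chi> v \<noteq> \<chi>' v} = {v}"
    using assms(1) unfolding num_diff_def by (auto simp: card_1_singleton_iff)
  have "\<chi>' = \<chi>(v := \<chi>' v)"
  proof
    fix u show "\<chi>' u = (\<chi>(v := \<chi>' v)) u"
      using v assms(2,3) by (cases "u \<in> V") (auto simp: PiE_iff extensional_def)
  qed
  with v show ?thesis using that by blast
qed

text \<open>This makes the holding probability nonnegative: every coloring at distance 1 is one of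
  the \<open>3 * card V\<close> single-vertex updates.\<close>

lemma P3_sum_le:
  assumes "\<chi> \<in> C3 L d"
  shows "(\<Sum>\<chi>'\<in>C3 L d - {\<chi>}. P3_off L d \<chi> \<chi>') \<le> 1"
proof -
  let ?V = "torus_verts L d"
  let ?N = "{\<chi>' \<in> C3 L d. num_diff ?V \<chi> \<chi>' = 1}"
  have "?N \<subseteq> (\<lambda>(v, c). \<chi>(v := c)) ` (?V \<times> {..<3})"
  proof
    fix \<chi>' assume N: "\<chi>' \<in> ?N"
    then obtain v where v: "v \<in> ?V" "\<chi>' = \<chi>(v := \<chi>' v)"
      using num_diff_1_obtain[of ?V \<chi> \<chi>' "{..<3}"] assms C3_PiE by (metis (lifting) mem_Collect_eq)
    moreover have "\<chi>' v \<in> {..<3}" using N v C3_PiE by blast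
    ultimately show "\<chi>' \<in> (\<lambda>(v, c). \<chi>(v := c)) ` (?V \<times> {..<3})"
      by (intro image_eqI[of _ _ "(v, \<chi>' v)"]) auto
  qed
  hence "card ?N \<le> card ((\<lambda>(v, c). \<chi>(v := c)) ` (?V \<times> {..<3::nat}))"
    by (intro card_mono finite_imageI finite_cartesian_product finite_torus_verts) auto
  also have "\<dots> \<le> card (?V \<times> {..<3::nat})"
    by (intro card_image_le finite_cartesian_product finite_torus_verts) auto
  finally have card: "card ?N \<le> 3 * card ?V" by (simp add: card_cartesian_product)
  have "(\<Sum>\<chi>'\<in>C3 L d - {\<chi>}. P3_off L d \<chi> \<chi>') \<le> (\<Sum>\<chi>'\<in>C3 L d. P3_off L d \<chi> \<chi>')"
    by (intro sum_mono2 finite_C3) (auto simp: P3_off_def)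
  also have "\<dots> = real (card ?N) / (3 * real (card ?V))"
    unfolding P3_off_def by (simp add: sum.If_cases finite_C3 Int_def conj_commute)
  also have "\<dots> \<le> 1" using card by (auto simp: divide_le_eq_1)
  finally show ?thesis .
qed

lemma P3_symmetric_chain: "symmetric_chain (C3 L d) (P3 L d)"
proof
  show "finite (C3 L d)" by (rule finite_C3)
next
  fix \<chi> \<chi>' assume "\<chi> \<in> C3 L d" "\<chi>' \<in> C3 L d"
  thus "P3 L d \<chi> \<chi>' \<ge> 0"
    using P3_sum_le by (auto simp: P3_def P3_off_def)
  show "P3 L d \<chi> \<chi>' = P3 L d \<chi>' \<chi>"
    by (auto simp: P3_def P3_off_def num_diff_sym)
next
  fix \<chi> assume \<chi>: "\<chi> \<in> C3 L d"
  have "(\<Sum>\<chi>'\<in>C3 L d. P3 L d \<chi> \<chi>') = P3 L d \<chi> \<chi> + (\<Sum>\<chi>'\<in>C3 L d - {\<chi>}. P3 L d \<chi> \<chi>')"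
    using \<chi> by (simp add: sum.remove finite_C3)
  also have "(\<Sum>\<chi>'\<in>C3 L d - {\<chi>}. P3 L d \<chi> \<chi>') = (\<Sum>\<chi>'\<in>C3 L d - {\<chi>}. P3_off L d \<chi> \<chi>')"
    by (intro sum.cong) (auto simp: P3_def)
  finally show "(\<Sum>\<chi>'\<in>C3 L d. P3 L d \<chi> \<chi>') = 1" by (simp add: P3_def)
qed

section \<open>Entropy and Shearer's inequality\<close>

definition fiber :: "'a set \<Rightarrow> ('a \<Rightarrow> 'b) \<Rightarrow> 'a \<Rightarrow> 'a set" where
  "fiber \<Omega> X \<omega> = {\<omega>' \<in> \<Omega>. X \<omega>' = X \<omega>}"

text \<open>Shannon entropy, in nats, of \<open>X\<close> under the uniform distribution on \<open>\<Omega>\<close>.\<close>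

definition entropy :: "'a set \<Rightarrow> ('a \<Rightarrow> 'b) \<Rightarrow> real" where
  "entropy \<Omega> X = (\<Sum>\<omega>\<in>\<Omega>. ln (real (card \<Omega>) / real (card (fiber \<Omega> X \<omega>)))) / real (card \<Omega>)"

lemma finite_fiber: "finite \<Omega> \<Longrightarrow> finite (fiber \<Omega> X \<omega>)"
  by (simp add: fiber_def)

lemma card_fiber_pos: "finite \<Omega> \<Longrightarrow> \<omega> \<in> \<Omega> \<Longrightarrow> card (fiber \<Omega> X \<omega>) > 0"
  by (auto simp: fiber_def card_gt_0_iff)

text \<open>Weighting by the inverse fiber size counts every value of \<open>X\<close> once.\<close>

lemma sum_inverse_card_fiber:
  assumes "finite \<Omega>"
  shows "(\<Sum>\<omega>\<in>\<Omega>. g (X \<omega>) / real (card (fiber \<Omega> X \<omega>))) = sum g (X ` \<Omega>)"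
proof -
  have "(\<Sum>\<omega>\<in>\<Omega>. g (X \<omega>) / real (card (fiber \<Omega> X \<omega>)))
      = (\<Sum>x\<in>X ` \<Omega>. \<Sum>\<omega>\<in>{\<omega> \<in> \<Omega>. X \<omega> = x}. g (X \<omega>) / real (card (fiber \<Omega> X \<omega>)))"
    using assms by (rule sum.image_gen)
  also have "\<dots> = (\<Sum>x\<in>X ` \<Omega>. g x)"
  proof (rule sum.cong[OF refl])
    fix x assume "x \<in> X ` \<Omega>"
    hence "card {\<omega> \<in> \<Omega>. X \<omega> = x} > 0" using assms by (auto simp: card_gt_0_iff)
    moreover have "(\<Sum>\<omega>\<in>{\<omega> \<in> \<Omega>. X \<omega> = x}. g (X \<omega>) / real (card (fiber \<Omega> X \<omega>)))
      = (\<Sum>\<omega>\<in>{\<omega> \<in> \<Omega>. X \<omega> = x}. g x / real (card {\<omega> \<in> \<Omega>. X \<omega> = x}))"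
      by (intro sum.cong) (auto simp: fiber_def)
    ultimately show "(\<Sum>\<omega>\<in>{\<omega> \<in> \<Omega>. X \<omega> = x}. g (X \<omega>) / real (card (fiber \<Omega> X \<omega>))) = g x"
      by simp
  qed
  finally show ?thesis .
qed

text \<open>Gibbs' inequality in coding form, for lengths in nats subject to Kraft's inequality. It
  follows from \<open>ln y \<le> y - 1\<close>, where \<open>y\<close> is the ratio of
  \<open>exp (- len)\<close> to the true probability.\<close>

lemma entropy_le_expected_length:
  assumes fin: "finite \<Omega>" and kraft: "(\<Sum>x\<in>X ` \<Omega>. exp (- len x)) \<le> 1"
  shows "entropy \<Omega> X \<le> (\<Sum>\<omega>\<in>\<Omega>. len (X \<omega>)) / real (card \<Omega>)"
proof (cases "\<Omega> = {}")
  case False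
  hence pos: "real (card \<Omega>) > 0" using fin by (simp add: card_gt_0_iff)
  have "(\<Sum>\<omega>\<in>\<Omega>. ln (real (card \<Omega>) / real (card (fiber \<Omega> X \<omega>))))
      \<le> (\<Sum>\<omega>\<in>\<Omega>. len (X \<omega>) + (real (card \<Omega>) * (exp (- len (X \<omega>)) / real (card (fiber \<Omega> X \<omega>))) - 1))"
  proof (rule sum_mono)
    fix \<omega> assume "\<omega> \<in> \<Omega>"
    hence c: "real (card (fiber \<Omega> X \<omega>)) > 0" using fin card_fiber_pos by fastforce
    let ?y = "real (card \<Omega>) * (exp (- len (X \<omega>)) / real (card (fiber \<Omega> X \<omega>)))"
    have "ln (real (card \<Omega>) / real (card (fiber \<Omega> X \<omega>))) = len (X \<omega>) + ln ?y"
      using c pos by (simp add: ln_mult ln_div)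
    also have "ln ?y \<le> ?y - 1" using c pos by (intro ln_le_minus_one) simp
    finally show "ln (real (card \<Omega>) / real (card (fiber \<Omega> X \<omega>))) \<le> len (X \<omega>) + (?y - 1)" by simp
  qed
  also have "\<dots> = (\<Sum>\<omega>\<in>\<Omega>. len (X \<omega>)) + real (card \<Omega>) * (\<Sum>x\<in>X ` \<Omega>. exp (- len x)) - real (card \<Omega>)"
    unfolding sum_inverse_card_fiber[OF fin, of "\<lambda>x. exp (- len x)" X, symmetric]
    by (simp add: sum.distrib sum_subtractf sum_distrib_left)
  also have "\<dots> \<le> (\<Sum>\<omega>\<in>\<Omega>. len (X \<omega>))"
    using mult_left_mono[OF kraft, of "real (card \<Omega>)"] by simp
  finally show ?thesis unfolding entropy_def using pos by (simp add: divide_right_mono)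
qed (simp add: entropy_def)

text \<open>The chain rule: the outcome itself has entropy \<open>ln (card \<Omega>)\<close>, and
  given \<open>X\<close> it is uniform on its fiber.\<close>

lemma ln_card_eq_entropy:
  assumes "finite \<Omega>" "\<Omega> \<noteq> {}"
  shows "ln (real (card \<Omega>)) = entropy \<Omega> X + (\<Sum>\<omega>\<in>\<Omega>. ln (real (card (fiber \<Omega> X \<omega>)))) / real (card \<Omega>)"
proof -
  have pos: "real (card \<Omega>) > 0" using assms by (simp add: card_gt_0_iff)
  have "(\<Sum>\<omega>\<in>\<Omega>. ln (real (card \<Omega>) / real (card (fiber \<Omega> X \<omega>))))
      = (\<Sum>\<omega>\<in>\<Omega>. ln (real (card \<Omega>)) - ln (real (card (fiber \<Omega> X \<omega>))))"
    using pos card_fiber_pos[OF assms(1), of _ X] by (intro sum.cong refl ln_divide_pos) auto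
  also have "\<dots> = real (card \<Omega>) * ln (real (card \<Omega>)) - (\<Sum>\<omega>\<in>\<Omega>. ln (real (card (fiber \<Omega> X \<omega>))))"
    by (simp add: sum_subtractf)
  finally show ?thesis unfolding entropy_def using pos by (simp add: field_simps)
qed

lemma entropy_mono:
  assumes fin: "finite \<Omega>"
    and imp: "\<And>\<omega> \<omega>'. \<omega> \<in> \<Omega> \<Longrightarrow> \<omega>' \<in> \<Omega> \<Longrightarrow> Y \<omega> = Y \<omega>' \<Longrightarrow> X \<omega> = X \<omega>'"
  shows "entropy \<Omega> X \<le> entropy \<Omega> Y"
proof -
  have "ln (real (card \<Omega>) / real (card (fiber \<Omega> X \<omega>)))
      \<le> ln (real (card \<Omega>) / real (card (fiber \<Omega> Y \<omega>)))" if \<omega>: "\<omega> \<in> \<Omega>" for \<omega>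
  proof -
    have "\<omega>' \<in> fiber \<Omega> X \<omega>" if "\<omega>' \<in> fiber \<Omega> Y \<omega>" for \<omega>'
      using imp[of \<omega>' \<omega>] \<omega> that unfolding fiber_def by blast
    hence "card (fiber \<Omega> Y \<omega>) \<le> card (fiber \<Omega> X \<omega>)"
      by (intro card_mono finite_fiber[OF fin] subsetI)
    moreover have "card \<Omega> > 0" using fin \<omega> by (auto simp: card_gt_0_iff)
    moreover have "card (fiber \<Omega> Y \<omega>) > 0" by (rule card_fiber_pos[OF fin \<omega>])
    ultimately show ?thesis by (simp add: ln_div)
  qed
  thus ?thesis unfolding entropy_def by (simp add: sum_mono divide_right_mono)
qed

text \<open>The hypotheses on \<open>J\<close> and \<open>M\<close> say that they are, up to relabelling of values, the pair
  \<open>(X, Y)\<close> and a common function of \<open>X\<close> and \<open>Y\<close>.\<close>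

lemma entropy_submodular:
  assumes fin: "finite \<Omega>"
    and J: "\<And>\<omega> \<omega>'. \<omega> \<in> \<Omega> \<Longrightarrow> \<omega>' \<in> \<Omega> \<Longrightarrow> J \<omega> = J \<omega>' \<longleftrightarrow> X \<omega> = X \<omega>' \<and> Y \<omega> = Y \<omega>'"
    and MX: "\<And>\<omega> \<omega>'. \<omega> \<in> \<Omega> \<Longrightarrow> \<omega>' \<in> \<Omega> \<Longrightarrow> X \<omega> = X \<omega>' \<Longrightarrow> M \<omega> = M \<omega>'"
    and MY: "\<And>\<omega> \<omega>'. \<omega> \<in> \<Omega> \<Longrightarrow> \<omega>' \<in> \<Omega> \<Longrightarrow> Y \<omega> = Y \<omega>' \<Longrightarrow> M \<omega> = M \<omega>'"
  shows "entropy \<Omega> J + entropy \<Omega> M \<le> entropy \<Omega> X + entropy \<Omega> Y"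
proof (cases "\<Omega> = {}")
  case False
  hence pos: "real (card \<Omega>) > 0" using fin by (simp add: card_gt_0_iff)
  let ?x = "\<lambda>\<omega>. real (card (fiber \<Omega> X \<omega>))" and ?y = "\<lambda>\<omega>. real (card (fiber \<Omega> Y \<omega>))"
  let ?j = "\<lambda>\<omega>. real (card (fiber \<Omega> J \<omega>))" and ?m = "\<lambda>\<omega>. real (card (fiber \<Omega> M \<omega>))"
  let ?I = "\<lambda>\<alpha> \<beta> \<omega>. if X \<alpha> = X \<omega> \<and> Y \<beta> = Y \<omega> then 1 else 0 :: real"
  have cx: "?x \<omega> = (\<Sum>\<alpha>\<in>\<Omega>. if X \<alpha> = X \<omega> then 1 else 0)" for \<omega>
    using fin by (simp add: fiber_def sum.If_cases Int_def)
  have cy: "?y \<omega> = (\<Sum>\<alpha>\<in>\<Omega>. if Y \<alpha> = Y \<omega> then 1 else 0)" for \<omega>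
    using fin by (simp add: fiber_def sum.If_cases Int_def)
  have xy: "?x \<omega> * ?y \<omega> = (\<Sum>\<alpha>\<in>\<Omega>. \<Sum>\<beta>\<in>\<Omega>. ?I \<alpha> \<beta> \<omega>)" for \<omega>
    unfolding cx cy sum_product by (intro sum.cong) auto
  \<comment> \<open>Only those \<omega> count that have the X-value of \<alpha> and the Y-value of
    \<beta>. If there are any, they form one fiber of \<open>J\<close>, on which the weights
    \<open>1 / ?j\<close> sum to 1 and \<open>M\<close> has the common value at \<alpha> and
    \<beta>.\<close>
  have inner: "(\<Sum>\<omega>\<in>\<Omega>. ?I \<alpha> \<beta> \<omega> / (?j \<omega> * ?m \<omega>)) \<le> (if M \<beta> = M \<alpha> then 1 / ?m \<alpha> else 0)"
    if \<alpha>: "\<alpha> \<in> \<Omega>" and \<beta>: "\<beta> \<in> \<Omega>" for \<alpha> \<beta>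
  proof (cases "\<exists>\<omega>\<in>\<Omega>. X \<alpha> = X \<omega> \<and> Y \<beta> = Y \<omega>")
    case True
    then obtain \<omega>\<^sub>0 where \<omega>\<^sub>0: "\<omega>\<^sub>0 \<in> \<Omega>" "X \<alpha> = X \<omega>\<^sub>0" "Y \<beta> = Y \<omega>\<^sub>0" by blast
    have M: "M \<alpha> = M \<omega>\<^sub>0" "M \<beta> = M \<omega>\<^sub>0" using \<omega>\<^sub>0 \<alpha> \<beta> MX MY by blast+
    have "(\<Sum>\<omega>\<in>\<Omega>. ?I \<alpha> \<beta> \<omega> / (?j \<omega> * ?m \<omega>)) = (\<Sum>\<omega>\<in>fiber \<Omega> J \<omega>\<^sub>0. 1 / (?j \<omega>\<^sub>0 * ?m \<alpha>))"
    proof (rule sum.mono_neutral_cong_right[OF fin])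
      show "fiber \<Omega> J \<omega>\<^sub>0 \<subseteq> \<Omega>" by (auto simp: fiber_def)
      show "\<forall>\<omega>\<in>\<Omega> - fiber \<Omega> J \<omega>\<^sub>0. ?I \<alpha> \<beta> \<omega> / (?j \<omega> * ?m \<omega>) = 0"
        using J \<omega>\<^sub>0 by (auto simp: fiber_def)
      fix \<omega> assume "\<omega> \<in> fiber \<Omega> J \<omega>\<^sub>0"
      hence \<omega>: "\<omega> \<in> \<Omega>" "J \<omega> = J \<omega>\<^sub>0" by (auto simp: fiber_def)
      hence "X \<omega> = X \<omega>\<^sub>0" "Y \<omega> = Y \<omega>\<^sub>0" using J \<omega>\<^sub>0 by blast+
      moreover from this have "M \<omega> = M \<omega>\<^sub>0" using MX \<omega> \<omega>\<^sub>0 by blast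
      ultimately show "?I \<alpha> \<beta> \<omega> / (?j \<omega> * ?m \<omega>) = 1 / (?j \<omega>\<^sub>0 * ?m \<alpha>)"
        using \<omega> \<omega>\<^sub>0 M by (simp add: fiber_def)
    qed
    also have "\<dots> = 1 / ?m \<alpha>" using card_fiber_pos[OF fin \<omega>\<^sub>0(1), of J] by simp
    finally show ?thesis using M by simp
  next
    case False
    hence "(\<Sum>\<omega>\<in>\<Omega>. ?I \<alpha> \<beta> \<omega> / (?j \<omega> * ?m \<omega>)) = 0" by (intro sum.neutral) auto
    thus ?thesis by simp
  qed
  have "(\<Sum>\<omega>\<in>\<Omega>. ?x \<omega> * ?y \<omega> / (?j \<omega> * ?m \<omega>))
      = (\<Sum>\<alpha>\<in>\<Omega>. \<Sum>\<beta>\<in>\<Omega>. \<Sum>\<omega>\<in>\<Omega>. ?I \<alpha> \<beta> \<omega> / (?j \<omega> * ?m \<omega>))"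
    unfolding xy sum_divide_distrib
    by (rule trans[OF sum.swap sum.cong[OF refl sum.swap]])
  also have "\<dots> \<le> (\<Sum>\<alpha>\<in>\<Omega>. \<Sum>\<beta>\<in>\<Omega>. if M \<beta> = M \<alpha> then 1 / ?m \<alpha> else 0)"
    by (intro sum_mono inner)
  also have "\<dots> = (\<Sum>\<alpha>\<in>\<Omega>. ?m \<alpha> * (1 / ?m \<alpha>))"
    using fin by (intro sum.cong refl) (simp add: fiber_def sum.If_cases Int_def)
  also have "\<dots> = (\<Sum>\<alpha>\<in>\<Omega>. 1)"
    using card_fiber_pos[OF fin, of _ M]
    by (intro sum.cong refl) (simp add: less_imp_neq[symmetric])
  finally have le: "(\<Sum>\<omega>\<in>\<Omega>. ?x \<omega> * ?y \<omega> / (?j \<omega> * ?m \<omega>)) \<le> real (card \<Omega>)" by simp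
  \<comment> \<open>Pointwise \<open>ln t \<le> t - 1\<close> for
    \<open>t = ?x * ?y / (?j * ?m)\<close>, whose mean is at most 1 by \<open>le\<close>.\<close>
  have "(\<Sum>\<omega>\<in>\<Omega>. ln (real (card \<Omega>) / ?j \<omega>) + ln (real (card \<Omega>) / ?m \<omega>))
      \<le> (\<Sum>\<omega>\<in>\<Omega>. ln (real (card \<Omega>) / ?x \<omega>) + ln (real (card \<Omega>) / ?y \<omega>)
          + (?x \<omega> * ?y \<omega> / (?j \<omega> * ?m \<omega>) - 1))"
  proof (rule sum_mono)
    fix \<omega> assume "\<omega> \<in> \<Omega>"
    hence p: "?x \<omega> > 0" "?y \<omega> > 0" "?j \<omega> > 0" "?m \<omega> > 0" 
      by (simp_all add: card_fiber_pos[OF fin])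
    have "ln (?x \<omega> * ?y \<omega> / (?j \<omega> * ?m \<omega>)) \<le> ?x \<omega> * ?y \<omega> / (?j \<omega> * ?m \<omega>) - 1"
      using p by (intro ln_le_minus_one) simp
    moreover have "ln (?x \<omega> * ?y \<omega> / (?j \<omega> * ?m \<omega>)) = ln (?x \<omega>) + ln (?y \<omega>) - ln (?j \<omega>) - ln (?m \<omega>)"
      using p by (simp add: ln_mult ln_div)
    ultimately show "ln (real (card \<Omega>) / ?j \<omega>) + ln (real (card \<Omega>) / ?m \<omega>)
        \<le> ln (real (card \<Omega>) / ?x \<omega>) + ln (real (card \<Omega>) / ?y \<omega>)
          + (?x \<omega> * ?y \<omega> / (?j \<omega> * ?m \<omega>) - 1)"
      using p pos by (simp add: ln_div)
  qed
  also have "\<dots> \<le> (\<Sum>\<omega>\<in>\<Omega>. ln (real (card \<Omega>) / ?x \<omega>) + ln (real (card \<Omega>) / ?y \<omega>))"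
    using le by (simp add: sum.distrib sum_subtractf)
  finally show ?thesis unfolding entropy_def using pos
    by (simp add: sum.distrib divide_right_mono flip: add_divide_distrib)
qed (simp add: entropy_def)

text \<open>Induction over \<open>R\<close>: by submodularity the gain from adding \<open>x\<close>
  to all of \<open>R\<close> is at most its gain over \<open>A w \<inter> R\<close>, and at least
  \<open>m\<close> of the sets \<open>A w\<close> collect it. Monotonicity makes the gain
  nonnegative, so surplus covering does no harm.\<close>

lemma shearer_set_function:
  fixes h :: "'v set \<Rightarrow> real"
  assumes submod: "\<And>S T. h (S \<union> T) + h (S \<inter> T) \<le> h S + h T"
    and mono: "\<And>S T. S \<subseteq> T \<Longrightarrow> h S \<le> h T"
    and empty: "h {} \<ge> 0"
    and W: "finite W" and R: "finite R"
    and cover: "\<And>x. x \<in> R \<Longrightarrow> m \<le> card {w \<in> W. x \<in> A w}"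
  shows "real m * h R \<le> (\<Sum>w\<in>W. h (A w \<inter> R)) + real m * h {}"
  using R cover
proof (induction R rule: finite_induct)
  case empty
  show ?case using assms(3) by (simp add: sum_nonneg)
next
  case (insert x R)
  let ?Wx = "{w \<in> W. x \<in> A w}"
  let ?\<delta> = "h (insert x R) - h R"
  have \<delta>: "?\<delta> \<ge> 0" using mono[of R "insert x R"] by auto
  have step: "h (A w \<inter> R) + (if x \<in> A w then ?\<delta> else 0) \<le> h (A w \<inter> insert x R)" for w
  proof (cases "x \<in> A w")
    case True
    have "(A w \<inter> insert x R) \<union> R = insert x R" "(A w \<inter> insert x R) \<inter> R = A w \<inter> R"
      using True insert.hyps by auto
    thus ?thesis using submod[of "A w \<inter> insert x R" R] True by simp
  qed simp
  have "real m * h (insert x R) = real m * h R + real m * ?\<delta>" by (simp add: algebra_simps)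
  also have "real m * h R \<le> (\<Sum>w\<in>W. h (A w \<inter> R)) + real m * h {}"
    using insert.prems by (intro insert.IH) auto
  also have "real m * ?\<delta> \<le> real (card ?Wx) * ?\<delta>"
    using insert.prems[of x] \<delta> by (intro mult_right_mono) auto
  also have "\<dots> = (\<Sum>w\<in>W. if x \<in> A w then ?\<delta> else 0)"
    using W by (simp add: sum.If_cases Int_def)
  finally have "real m * h (insert x R)
      \<le> (\<Sum>w\<in>W. h (A w \<inter> R) + (if x \<in> A w then ?\<delta> else 0)) + real m * h {}"
    by (simp add: sum.distrib)
  also have "\<dots> \<le> (\<Sum>w\<in>W. h (A w \<inter> insert x R)) + real m * h {}"
    using sum_mono[of W, OF step] by simp
  finally show ?case .
qed

lemma shearer:
  fixes c :: "'a \<Rightarrow> 'v \<Rightarrow> 'b"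
  assumes fin: "finite \<Omega>" and W: "finite W" and R: "finite R"
    and sub: "\<And>w. w \<in> W \<Longrightarrow> A w \<subseteq> R"
    and cover: "\<And>x. x \<in> R \<Longrightarrow> m \<le> card {w \<in> W. x \<in> A w}"
  shows "real m * entropy \<Omega> (\<lambda>\<omega>. restrict (c \<omega>) R) \<le> (\<Sum>w\<in>W. entropy \<Omega> (\<lambda>\<omega>. restrict (c \<omega>) (A w)))"
proof -
  define h where "h S = entropy \<Omega> (\<lambda>\<omega>. restrict (c \<omega>) S)" for S
  have eq: "restrict f S = restrict g S \<longleftrightarrow> (\<forall>x\<in>S. f x = g x)" for f g :: "'v \<Rightarrow> 'b" and S
    by (metis restrict_apply restrict_ext)
  have "fiber \<Omega> (\<lambda>\<omega>. restrict (c \<omega>) {}) \<omega> = \<Omega>" for \<omega>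
    by (simp add: fiber_def restrict_def)
  hence h0: "h {} = 0" by (simp add: h_def entropy_def)
  have "real m * h R \<le> (\<Sum>w\<in>W. h (A w \<inter> R)) + real m * h {}"
  proof (rule shearer_set_function[OF _ _ _ W R cover])
    show "h (S \<union> T) + h (S \<inter> T) \<le> h S + h T" for S T
      unfolding h_def by (rule entropy_submodular[OF fin]) (auto simp: eq)
    show "h S \<le> h T" if "S \<subseteq> T" for S T
      unfolding h_def using that by (intro entropy_mono[OF fin]) (auto simp: eq)
  qed (simp_all add: h0)
  also have "(\<Sum>w\<in>W. h (A w \<inter> R)) = (\<Sum>w\<in>W. h (A w))"
    using sub by (intro sum.cong refl arg_cong[of _ _ h]) auto
  finally show ?thesis by (simp add: h0 flip: h_def)
qed

section \<open>Isoperimetry in the even half of the hypercube\<close>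

text \<open>Vertices of the hypercube are subsets of \<open>{..<n}\<close>; this adds the basis
  vector of direction \<open>k\<close>.\<close>

definition flip :: "nat \<Rightarrow> nat set \<Rightarrow> nat set" where
  "flip k X = sym_diff X {k}"

definition even_verts :: "nat \<Rightarrow> nat set set" where
  "even_verts n = {X. X \<subseteq> {..<n} \<and> even (card X)}"

definition odd_verts :: "nat \<Rightarrow> nat set set" where
  "odd_verts n = {X. X \<subseteq> {..<n} \<and> odd (card X)}"

lemma even_card_sym_diff:
  assumes "finite A" "finite B"
  shows "even (card (sym_diff A B)) \<longleftrightarrow> (even (card A) \<longleftrightarrow> even (card B))"
proof -
  have "card (sym_diff A B) = card (A - B) + card (B - A)"
    using assms by (intro card_Un_disjoint) auto
  moreover have "card A = card (A - B) + card (A \<inter> B)" "card B = card (B - A) + card (A \<inter> B)"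
    using assms by (metis card_Diff_subset_Int card_mono finite_Int inf_le1 le_add_diff_inverse2
    inf_commute)+
  ultimately show ?thesis by auto
qed

lemma flip_flip [simp]: "flip k (flip k X) = X"
  by (auto simp: flip_def)

lemma flip_commute: "flip i (flip j X) = flip j (flip i X)"
  by (auto simp: flip_def)

lemma flip_subset: "X \<subseteq> {..<n} \<Longrightarrow> k < n \<Longrightarrow> flip k X \<subseteq> {..<n}"
  by (auto simp: flip_def)

lemma flip_odd: "w \<in> odd_verts n \<Longrightarrow> k < n \<Longrightarrow> flip k w \<in> even_verts n"
  and flip_even: "x \<in> even_verts n \<Longrightarrow> k < n \<Longrightarrow> flip k x \<in> odd_verts n"
proof -
  show "flip k w \<in> even_verts n" if "w \<in> odd_verts n" "k < n"
    using that flip_subset[of w n k] finite_subset[of w "{..<n}"] even_card_sym_diff[of w "{k}"]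
    by (simp add: even_verts_def odd_verts_def flip_def)
  show "flip k x \<in> odd_verts n" if "x \<in> even_verts n" "k < n"
    using that flip_subset[of x n k] finite_subset[of x "{..<n}"] even_card_sym_diff[of x "{k}"]
    by (simp add: even_verts_def odd_verts_def flip_def)
qed

lemma finite_even_verts [simp]: "finite (even_verts n)"
  and finite_odd_verts [simp]: "finite (odd_verts n)"
  unfolding even_verts_def odd_verts_def by (auto intro: finite_subset[of _ "Pow {..<n}"])

lemma card_parity_verts:
  assumes "n \<ge> 1"
  shows "card (even_verts n) = 2 ^ (n - 1)" "card (odd_verts n) = 2 ^ (n - 1)"
proof -
  have "bij_betw (flip 0) (even_verts n) (odd_verts n)"
    using assms by (intro bij_betwI[where g = "flip 0"]) (auto intro: flip_even flip_odd)
  hence eq: "card (even_verts n) = card (odd_verts n)" by (rule bij_betw_same_card)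
  have "even_verts n \<union> odd_verts n = Pow {..<n}" "even_verts n \<inter> odd_verts n = {}"
    by (auto simp: even_verts_def odd_verts_def)
  hence "card (even_verts n) + card (odd_verts n) = 2 ^ n"
    by (metis card_Pow card_Un_disjoint card_lessThan finite_even_verts finite_odd_verts
    finite_lessThan)
  moreover have "2 ^ n = 2 * (2::nat) ^ (n - 1)" using assms by (cases n) auto
  ultimately show "card (even_verts n) = 2 ^ (n - 1)" "card (odd_verts n) = 2 ^ (n - 1)"
    using eq by simp_all
qed

lemma sym_diff_even: "x \<in> even_verts n \<Longrightarrow> y \<in> even_verts n \<Longrightarrow> sym_diff x y \<in> even_verts n"
  using even_card_sym_diff[of x y] finite_subset[of _ "{..<n}"]
  by (auto simp: even_verts_def)

text \<open>A crossing pair \<open>x\<close>, \<open>x + e_i + e_j\<close> is counted from both of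
  its ends; for \<open>i = j\<close> the count is 0.\<close>

definition cut :: "nat \<Rightarrow> nat set set \<Rightarrow> nat \<Rightarrow> nat \<Rightarrow> nat" where
  "cut n S i j = card {x \<in> even_verts n. (x \<in> S) \<noteq> (flip i (flip j x) \<in> S)}"

text \<open>The map \<open>flip i\<close> turns a pair of even vertices at distance two into two
  neighbors of an odd vertex between them, which is how blocks see it.\<close>

lemma cut_odd_centre:
  assumes "i < n"
  shows "card {w \<in> odd_verts n. (flip i w \<in> S) \<noteq> (flip j w \<in> S)} = cut n S i j"
  unfolding cut_def
proof (rule bij_betw_same_card)
  show "bij_betw (flip i) {w \<in> odd_verts n. (flip i w \<in> S) \<noteq> (flip j w \<in> S)}
      {x \<in> even_verts n. (x \<in> S) \<noteq> (flip i (flip j x) \<in> S)}"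
    using assms
    by (intro bij_betwI[where g = "flip i"])
       (auto intro: flip_even flip_odd simp: flip_commute[of i j])
qed

text \<open>For fixed \<open>j\<close> every even subset of \<open>{..<n}\<close> arises from
  exactly one \<open>I\<close> avoiding \<open>j\<close>, so these \<open>I\<close> index all
  differences of two even vertices.\<close>

definition even_hull :: "nat \<Rightarrow> nat set \<Rightarrow> nat set" where
  "even_hull j I = (if even (card I) then I else insert j I)"

lemma even_hull_even:
  assumes "I \<subseteq> {..<n} - {j}" "j < n"
  shows "even_hull j I \<in> even_verts n"
  using assms finite_subset[of I "{..<n}"]
  by (auto simp: even_hull_def even_verts_def subset_iff card_insert_if)

text \<open>Walk from \<open>x\<close> to \<open>sym_diff x (even_hull j I)\<close> through even vertices by flipping
  \<open>j\<close> together with the elements of \<open>I\<close> one after the other.\<close>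

lemma cut_path:
  assumes "finite I" "I \<subseteq> {..<n} - {j}" "j < n"
  shows "card {x \<in> even_verts n. (x \<in> S) \<noteq> (sym_diff x (even_hull j I) \<in> S)} \<le> (\<Sum>i\<in>I. cut n S i j)"
  using assms
proof (induction I rule: finite_induct)
  case empty
  thus ?case by (simp add: even_hull_def)
next
  case (insert i I)
  let ?h = "even_hull j I"
  let ?E = "even_verts n"
  \<comment> \<open>Adding \<open>i\<close> changes the parity of \<open>I\<close>, so the
    membership of \<open>j\<close> in the hull switches as well.\<close>
  have step: "sym_diff x (even_hull j (insert i I)) = flip i (flip j (sym_diff x ?h))" for x
    using insert.hyps insert.prems by (auto simp: even_hull_def flip_def)
  have h: "?h \<in> ?E" using insert.prems by (intro even_hull_even) auto
  let ?A = "{x \<in> ?E. (x \<in> S) \<noteq> (sym_diff x ?h \<in> S)}"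
  let ?B = "{x \<in> ?E. (sym_diff x ?h \<in> S) \<noteq> (flip i (flip j (sym_diff x ?h)) \<in> S)}"
  have "card {x \<in> ?E. (x \<in> S) \<noteq> (sym_diff x (even_hull j (insert i I)) \<in> S)} \<le> card (?A \<union> ?B)"
    unfolding step by (intro card_mono) auto
  also have "\<dots> \<le> card ?A + card ?B" by (rule card_Un_le)
  \<comment> \<open>Translation by the even set \<open>?h\<close> permutes the even vertices, so the
    last stage of the walk crosses \<open>S\<close> as often as the move by \<open>e_i + e_j\<close>
    does from all even vertices.\<close>
  also have "card ?B = cut n S i j"
    unfolding cut_def
  proof (rule bij_betw_same_card)
    have inv: "sym_diff (sym_diff x ?h) ?h = x" for x by auto
    show "bij_betw (\<lambda>x. sym_diff x ?h) ?B {x \<in> ?E. (x \<in> S) \<noteq> (flip i (flip j x) \<in> S)}"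
      by (intro bij_betwI[where g = "\<lambda>x. sym_diff x ?h"])
       (auto simp only: inv mem_Collect_eq Pi_iff intro: sym_diff_even h)
  qed
  also have "card ?A \<le> (\<Sum>i\<in>I. cut n S i j)" using insert by auto
  finally show ?case using insert.hyps by simp
qed

lemma sum_Pow_swap:
  fixes f :: "'i \<Rightarrow> nat"
  assumes "finite M"
  shows "(\<Sum>I\<in>Pow M. \<Sum>i\<in>I. f i) = 2 ^ (card M - 1) * (\<Sum>i\<in>M. f i)"
proof -
  have "(\<Sum>I\<in>Pow M. \<Sum>i\<in>I. f i) = (\<Sum>I\<in>Pow M. \<Sum>i\<in>M. if i \<in> I then f i else 0)"
    using assms by (intro sum.cong[OF refl]) (simp add: sum.If_cases Int_absorb1)
  also have "\<dots> = (\<Sum>i\<in>M. \<Sum>I\<in>Pow M. if i \<in> I then f i else 0)" by (rule sum.swap)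
  also have "\<dots> = (\<Sum>i\<in>M. 2 ^ (card M - 1) * f i)"
  proof (rule sum.cong[OF refl])
    fix i assume i: "i \<in> M"
    have "bij_betw (insert i) (Pow (M - {i})) (Pow M \<inter> {I. i \<in> I})"
      using i by (intro bij_betwI[where g = "\<lambda>I. I - {i}"]) auto
    hence "card (Pow M \<inter> {I. i \<in> I}) = 2 ^ (card M - 1)"
      using assms i by (metis bij_betw_same_card card_Diff_singleton card_Pow finite_Diff)
    thus "(\<Sum>I\<in>Pow M. if i \<in> I then f i else 0) = 2 ^ (card M - 1) * f i"
      using assms by (simp add: sum.If_cases)
  qed
  finally show ?thesis by (simp add: sum_distrib_left)
qed

text \<open>Canonical paths: an ordered pair of even vertices separated by \<open>S\<close> is given
  by its start and its difference, that is, by a set \<open>I\<close> avoiding \<open>j\<close>, and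
  its walk from \<open>cut_path\<close> must cross \<open>S\<close>. Each \<open>i\<close> other
  than \<open>j\<close> is in half of the \<open>2 ^ (n - 1)\<close> sets \<open>I\<close>.\<close>

lemma cut_isoperimetry_one_direction:
  assumes S: "S \<subseteq> even_verts n" and j: "j < n"
  shows "2 * card S * card (even_verts n - S) \<le> 2 ^ (n - 2) * (\<Sum>i\<in>{..<n} - {j}. cut n S i j)"
proof -
  let ?E = "even_verts n"
  let ?M = "{..<n} - {j}"
  let ?T = "\<lambda>I. {x \<in> ?E. (x \<in> S) \<noteq> (sym_diff x (even_hull j I) \<in> S)}"
  let ?Q = "S \<times> (?E - S) \<union> (?E - S) \<times> S"
  have fS: "finite S" using S finite_subset by fastforce
  have "2 * card S * card (?E - S) = card ?Q"
    using fS by (subst card_Un_disjoint) (auto simp: card_cartesian_product)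
  also have "\<dots> \<le> card (SIGMA I:Pow ?M. ?T I)"
  proof (rule card_inj_on_le)
    let ?g = "\<lambda>(x, y). (sym_diff x y - {j}, x)"
    have hull: "even_hull j (sym_diff x y - {j}) = sym_diff x y" if "x \<in> ?E" "y \<in> ?E" for x y
    proof -
      have e: "even (card (sym_diff x y))" "finite (sym_diff x y)"
        using sym_diff_even[OF that] finite_subset[of "sym_diff x y" "{..<n}"]
        unfolding even_verts_def by auto
      show ?thesis
      proof (cases "j \<in> sym_diff x y")
        case True
        hence "card (sym_diff x y) = Suc (card (sym_diff x y - {j}))"
          using e by (metis card_Suc_Diff1)
        thus ?thesis using e True unfolding even_hull_def by (auto simp del: Diff_insert0)
      next
        case False
        thus ?thesis using e unfolding even_hull_def by simp
      qed
    qed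
    have cancel: "sym_diff x (sym_diff x y) = y" for x y :: "nat set" by auto
    have Q: "fst p \<in> ?E" "snd p \<in> ?E" "(fst p \<in> S) \<noteq> (snd p \<in> S)" if "p \<in> ?Q" for p
      using that S by auto
    show "inj_on ?g ?Q"
      by (rule inj_on_inverseI[where g = "\<lambda>(I, x). (x, sym_diff x (even_hull j I))"])
         (simp only: split_def fst_conv snd_conv hull[OF Q(1,2)] cancel prod.collapse)
    show "?g ` ?Q \<subseteq> (SIGMA I:Pow ?M. ?T I)"
    proof (rule image_subsetI)
      fix p assume p: "p \<in> ?Q"
      have "sym_diff (fst p) (snd p) \<subseteq> {..<n}"
        using sym_diff_even[OF Q(1,2)[OF p]] unfolding even_verts_def by (elim CollectE conjE)
      hence "sym_diff (fst p) (snd p) - {j} \<in> Pow ?M" by (intro PowI Diff_mono order_refl)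
      moreover have
        "(fst p \<in> S) \<noteq> (sym_diff (fst p) (even_hull j (sym_diff (fst p) (snd p) - {j})) \<in> S)"
        using Q(3)[OF p] by (simp only: hull[OF Q(1,2)[OF p]] cancel not_False_eq_True)
      hence "fst p \<in> ?T (sym_diff (fst p) (snd p) - {j})" using Q(1)[OF p] by (intro CollectI conjI)
      ultimately show "?g p \<in> (SIGMA I:Pow ?M. ?T I)"
        by (simp only: split_def fst_conv snd_conv mem_Sigma_iff simp_thms)
    qed
  qed auto
  also have "\<dots> = (\<Sum>I\<in>Pow ?M. card (?T I))" by (intro card_SigmaI) auto
  also have "\<dots> \<le> (\<Sum>I\<in>Pow ?M. \<Sum>i\<in>I. cut n S i j)"
    using j finite_subset[of _ ?M] by (intro sum_mono cut_path) auto
  also have "\<dots> = 2 ^ (n - 2) * (\<Sum>i\<in>?M. cut n S i j)"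
    using j by (subst sum_Pow_swap) (auto simp: numeral_2_eq_2)
  finally show ?thesis .
qed

text \<open>Sums the bound over all \<open>j\<close> and regroups the crossings by the odd vertex in
  the middle.\<close>

lemma cut_isoperimetry:
  assumes S: "S \<subseteq> even_verts n"
  shows "n * (2 * card S * card (even_verts n - S)) \<le>
    2 ^ (n - 2) * (\<Sum>w\<in>odd_verts n. card {(i, j). i < n \<and> j < n \<and> (flip i w \<in> S) \<noteq> (flip j w \<in> S)})"
proof -
  let ?R = "\<lambda>i j w. (flip i w \<in> S) \<noteq> (flip j w \<in> S)"
  have "n * (2 * card S * card (even_verts n - S)) = (\<Sum>j<n. 2 * card S * card (even_verts n - S))"
    by simp
  also have "\<dots> \<le> (\<Sum>j<n. 2 ^ (n - 2) * (\<Sum>i\<in>{..<n} - {j}. cut n S i j))"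
    using S by (intro sum_mono cut_isoperimetry_one_direction) auto
  also have "\<dots> \<le> (\<Sum>j<n. 2 ^ (n - 2) * (\<Sum>i<n. cut n S i j))"
    by (intro sum_mono mult_le_mono2 sum_mono2) auto
  also have "\<dots> = 2 ^ (n - 2) * (\<Sum>j<n. \<Sum>i<n. cut n S i j)"
    by (simp add: sum_distrib_left)
  also have "(\<Sum>j<n. \<Sum>i<n. cut n S i j) = (\<Sum>i<n. \<Sum>j<n. \<Sum>w\<in>odd_verts n. if ?R i j w then 1 else 0)"
    by (subst sum.swap, intro sum.cong refl)
       (simp add: sum.If_cases Int_def flip: cut_odd_centre)
  also have "\<dots> = (\<Sum>w\<in>odd_verts n. \<Sum>i<n. \<Sum>j<n. if ?R i j w then 1 else 0)"
    by (rule trans[OF sum.cong[OF refl sum.swap] sum.swap])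
  also have "\<dots> = (\<Sum>w\<in>odd_verts n. card {(i, j). i < n \<and> j < n \<and> ?R i j w})"
  proof (rule sum.cong[OF refl])
    fix w
    have "(\<Sum>i<n. \<Sum>j<n. if ?R i j w then 1 else 0 :: nat)
        = (\<Sum>p\<in>{..<n} \<times> {..<n}. if ?R (fst p) (snd p) w then 1 else 0)"
      by (simp add: sum.cartesian_product split_def)
    also have "\<dots> = card (({..<n} \<times> {..<n}) \<inter> {p. ?R (fst p) (snd p) w})"
      by (simp add: sum.If_cases)
    also have "({..<n} \<times> {..<n}) \<inter> {p. ?R (fst p) (snd p) w} = {(i, j). i < n \<and> j < n \<and> ?R i j w}"
      by auto
    finally show "(\<Sum>i<n. \<Sum>j<n. if ?R i j w then 1 else 0) = card {(i, j). i < n \<and> j < n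
        \<and> ?R i j w}" .
  qed
  finally show ?thesis .
qed

section \<open>Encoding a block\<close>

definition nbr_colors :: "nat \<Rightarrow> (nat set \<Rightarrow> nat) \<Rightarrow> nat set \<Rightarrow> nat set" where
  "nbr_colors n g v = (\<lambda>j. g (flip j v)) ` {..<n}"

definition cube_proper :: "nat \<Rightarrow> (nat set \<Rightarrow> nat) \<Rightarrow> bool" where
  "cube_proper n g \<longleftrightarrow> (\<forall>X\<subseteq>{..<n}. g X < 3 \<and> (\<forall>k<n. g (flip k X) \<noteq> g X))"

definition pairs :: "nat \<Rightarrow> (nat \<times> nat) set" where
  "pairs n = {(i, j). i < j \<and> j < n}"

definition alike_pairs :: "nat \<Rightarrow> (nat \<Rightarrow> nat set) \<Rightarrow> (nat \<times> nat) set" where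
  "alike_pairs n \<tau> = {(i, j) \<in> pairs n. \<tau> i = \<tau> j \<and> card (\<tau> i) = 2}"

text \<open>Ordered pairs, whereas \<open>alike_pairs\<close> are unordered: this doubles the ratio
  of the two coefficients in \<open>alike_unlike_bound\<close> to 4.\<close>

definition unlike_pairs :: "nat \<Rightarrow> (nat \<Rightarrow> nat set) \<Rightarrow> (nat \<times> nat) set" where
  "unlike_pairs n \<tau> = {(i, j). i < n \<and> j < n \<and> \<tau> i \<noteq> \<tau> j}"

lemma finite_pairs [simp]: "finite (pairs n)"
  by (rule finite_subset[of _ "{..<n} \<times> {..<n}"]) (auto simp: pairs_def)

lemma finite_unlike_pairs [simp]: "finite (unlike_pairs n \<tau>)"
  by (rule finite_subset[of _ "{..<n} \<times> {..<n}"]) (auto simp: unlike_pairs_def)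

lemma sum_square_split:
  fixes f :: "nat \<Rightarrow> nat \<Rightarrow> nat"
  assumes sym: "\<And>i j. f i j = f j i"
  shows "(\<Sum>i<n. \<Sum>j<n. f i j) = 2 * (\<Sum>(i, j)\<in>pairs n. f i j) + (\<Sum>i<n. f i i)"
proof -
  let ?swapped = "(\<lambda>(i, j). (j, i)) ` pairs n" and ?diag = "(\<lambda>i. (i, i)) ` {..<n}"
  have "{..<n} \<times> {..<n} = (pairs n \<union> ?swapped) \<union> ?diag"
    by (auto simp: pairs_def image_iff split_def)
  moreover have "(pairs n \<union> ?swapped) \<inter> ?diag = {}" "pairs n \<inter> ?swapped = {}"
    by (auto simp: pairs_def)
  ultimately have "(\<Sum>(i, j)\<in>{..<n} \<times> {..<n}. f i j)
      = (\<Sum>(i, j)\<in>pairs n. f i j) + (\<Sum>(i, j)\<in>?swapped. f i j) + (\<Sum>(i, j)\<in>?diag. f i j)"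
    by (simp add: sum.union_disjoint)
  also have "(\<Sum>(i, j)\<in>?swapped. f i j) = (\<Sum>(i, j)\<in>pairs n. f i j)"
    by (subst sum.reindex) (auto simp: inj_on_def split_def sym intro!: sum.cong)
  also have "(\<Sum>(i, j)\<in>?diag. f i j) = (\<Sum>i<n. f i i)"
    by (subst sum.reindex) (auto simp: inj_on_def)
  finally show ?thesis by (simp add: sum.cartesian_product)
qed

lemma card_pairs: "2 * card (pairs n) = n * (n - 1)"
  using sum_square_split[of "\<lambda>_ _. 1" n] by (simp add: split_def diff_mult_distrib2)

lemma card_unlike_pairs: "card (unlike_pairs n \<tau>) = (\<Sum>i<n. \<Sum>j<n. if \<tau> i \<noteq> \<tau> j then 1 else 0)"
proof -
  have "unlike_pairs n \<tau> = {p \<in> {..<n} \<times> {..<n}. \<tau> (fst p) \<noteq> \<tau> (snd p)}"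
    by (auto simp: unlike_pairs_def)
  also have "card \<dots> = (\<Sum>p\<in>{..<n} \<times> {..<n}. if \<tau> (fst p) \<noteq> \<tau> (snd p) then 1 else 0)"
    by (simp add: sum.If_cases Int_def)
  also have "\<dots> = (\<Sum>i<n. \<Sum>j<n. if \<tau> i \<noteq> \<tau> j then 1 else 0)"
    by (simp add: sum.cartesian_product split_def)
  finally show ?thesis .
qed

text \<open>A pair of equal two-element types is paid for by two two-element types; a pair of distinct
  types still has at least one of them, although it allows no choice.\<close>

lemma alike_unlike_bound:
  assumes card: "\<And>i. i < n \<Longrightarrow> card (\<tau> i) \<in> {1, 2}"
    and common: "\<And>i. i < n \<Longrightarrow> a \<in> \<tau> i"
  shows "4 * card (alike_pairs n \<tau>) + card (unlike_pairs n \<tau>)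
    \<le> 2 * (n - 1) * card {i. i < n \<and> card (\<tau> i) = 2}"
proof -
  let ?z = "\<lambda>i. if card (\<tau> i) = 2 then 1 else 0 :: nat"
  let ?e = "\<lambda>i j. if \<tau> i = \<tau> j \<and> card (\<tau> i) = 2 then 1 else 0 :: nat"
  let ?u = "\<lambda>i j. if \<tau> i \<noteq> \<tau> j then 1 else 0 :: nat"
  let ?Z = "\<Sum>i<n. ?z i"
  \<comment> \<open>Since all types contain \<open>a\<close>, two distinct ones cannot both be
    singletons.\<close>
  have single: "\<tau> i = {a}" if "i < n" "card (\<tau> i) \<noteq> 2" for i
    using card[OF that(1)] common[OF that(1)] that(2) by (auto simp: card_1_singleton_iff)
  have "(\<Sum>i<n. \<Sum>j<n. 2 * ?e i j + ?u i j) \<le> (\<Sum>i<n. \<Sum>j<n. ?z i + ?z j)"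
    using single by (intro sum_mono) auto
  also have "\<dots> = 2 * (n * ?Z)"
    by (simp add: sum.distrib mult.commute flip: sum_distrib_left)
  also have "(\<Sum>i<n. \<Sum>j<n. 2 * ?e i j + ?u i j)
      = 2 * (\<Sum>i<n. \<Sum>j<n. ?e i j) + card (unlike_pairs n \<tau>)"
    by (simp add: sum.distrib sum_distrib_left card_unlike_pairs)
  \<comment> \<open>The diagonal contributes \<open>?Z\<close>, which turns the factor
    \<open>n\<close> into \<open>n - 1\<close>.\<close>
  also have "(\<Sum>i<n. \<Sum>j<n. ?e i j) = 2 * (\<Sum>(i, j)\<in>pairs n. ?e i j) + (\<Sum>i<n. ?e i i)"
    by (rule sum_square_split) auto
  also have "(\<Sum>(i, j)\<in>pairs n. ?e i j) = card (alike_pairs n \<tau>)"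
    by (simp add: alike_pairs_def split_def sum.If_cases Int_def)
  also have "(\<Sum>i<n. ?e i i) = ?Z" by simp
  also have "?Z = card {i. i < n \<and> card (\<tau> i) = 2}"
    by (simp add: sum.If_cases Int_def)
  finally show ?thesis by (cases n) (simp_all add: algebra_simps)
qed

text \<open>Average over \<open>k\<close>: the numbers of entries differing from the
  \<open>k\<close>-th one add up to the number of unlike pairs.\<close>

lemma ex_few_deviants:
  assumes "n > 0"
  shows "\<exists>k<n. n * card {i. i < n \<and> \<tau> i \<noteq> \<tau> k} \<le> card (unlike_pairs n \<tau>)"
proof (rule ccontr)
  assume "\<not> ?thesis"
  hence "(\<Sum>k<n. card (unlike_pairs n \<tau>)) < (\<Sum>k<n. n * card {i. i < n \<and> \<tau> i \<noteq> \<tau> k})"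
    using assms by (intro sum_strict_mono) auto
  also have "\<dots> = n * (\<Sum>k<n. \<Sum>i<n. if \<tau> i \<noteq> \<tau> k then 1 else 0)"
    by (simp add: sum_distrib_left sum.If_cases Int_def)
  also have "\<dots> = n * card (unlike_pairs n \<tau>)"
    unfolding card_unlike_pairs by (subst sum.swap) simp
  finally show False by simp
qed

text \<open>Vectors of types are encoded by their most popular entry together with
  the positions and values of the deviating entries, each of which costs \<open>ln n\<close>.\<close>

lemma type_vector_kraft:
  assumes n: "n > 0"
  shows "(\<Sum>\<tau>\<in>{..<n} \<rightarrow>\<^sub>E Pow {..<3::nat}. exp (- (real (card (unlike_pairs n \<tau>)) / real n
      * ln (real n))))
    \<le> 8 * exp 7"
proof -
  let ?T = "Pow {..<3::nat}"
  \<comment> \<open>The weight is \<open>1 / n\<close> to the power of the number of deviations from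
    \<open>t\<close>. Summing over all \<open>t\<close> avoids selecting the most popular entry, and
    each summand factorizes over the positions.\<close>
  let ?W = "\<lambda>t \<tau>. \<Prod>i<n. if \<tau> i = t then 1 else 1 / real n"
  have "(\<Sum>\<tau>\<in>{..<n} \<rightarrow>\<^sub>E ?T. exp (- (real (card (unlike_pairs n \<tau>)) / real n * ln (real n))))
      \<le> (\<Sum>\<tau>\<in>{..<n} \<rightarrow>\<^sub>E ?T. \<Sum>t\<in>?T. ?W t \<tau>)"
  proof (rule sum_mono)
    fix \<tau> assume \<tau>: "\<tau> \<in> {..<n} \<rightarrow>\<^sub>E ?T"
    obtain k where k: "k < n" "n * card {i. i < n \<and> \<tau> i \<noteq> \<tau> k} \<le> card (unlike_pairs n \<tau>)"
      using ex_few_deviants[OF n] by blast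
    let ?D = "{i. i < n \<and> \<tau> i \<noteq> \<tau> k}"
    have "real n * real (card ?D) \<le> real (card (unlike_pairs n \<tau>))"
      using k(2) by (metis of_nat_le_iff of_nat_mult)
    hence "real (card ?D) \<le> real (card (unlike_pairs n \<tau>)) / real n"
      using n by (simp add: field_simps)
    hence "real (card ?D) * ln (real n) \<le> real (card (unlike_pairs n \<tau>)) / real n * ln (real n)"
      using n by (intro mult_right_mono) auto
    hence "exp (- (real (card (unlike_pairs n \<tau>)) / real n * ln (real n)))
        \<le> exp (- (real (card ?D) * ln (real n)))"
      by simp
    also have "\<dots> = (1 / real n) ^ card ?D"
      using n by (simp add: exp_minus exp_of_nat_mult power_one_over inverse_eq_divide)
    also have "\<dots> = ?W (\<tau> k) \<tau>"
      by (simp add: prod.If_cases Int_def)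
    also have "\<dots> \<le> (\<Sum>t\<in>?T. ?W t \<tau>)"
      using \<tau> k(1) by (intro member_le_sum prod_nonneg) auto
    finally show "exp (- (real (card (unlike_pairs n \<tau>)) / real n * ln (real n)))
        \<le> (\<Sum>t\<in>?T. ?W t \<tau>)" .
  qed
  also have "\<dots> = (\<Sum>t\<in>?T. \<Sum>\<tau>\<in>{..<n} \<rightarrow>\<^sub>E ?T. ?W t \<tau>)" by (rule sum.swap)
  also have "\<dots> = (\<Sum>t\<in>?T. \<Prod>i<n. \<Sum>s\<in>?T. if s = t then 1 else 1 / real n)"
    by (intro sum.cong refl prod_sum_PiE[symmetric]) auto
  \<comment> \<open>Three colors give 8 types, 7 of them different from \<open>t\<close>.\<close>
  also have "\<dots> = (\<Sum>t\<in>?T. (1 + 7 / real n) ^ n)"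
  proof (rule sum.cong[OF refl])
    fix t assume t: "t \<in> ?T"
    have "(\<Sum>s\<in>?T. if s = t then 1 else 1 / real n) = 1 + (\<Sum>s\<in>?T - {t}. 1 / real n)"
      using t by (subst sum.remove[of _ t]) auto
    also have "\<dots> = 1 + 7 / real n"
      using t by (simp add: card_Diff_singleton card_Pow)
    finally show "(\<Prod>i<n. \<Sum>s\<in>?T. if s = t then 1 else 1 / real n) = (1 + 7 / real n) ^ n" by simp
  qed
  also have "\<dots> = 8 * (1 + 7 / real n) ^ n" by (simp add: card_Pow)
  also have "(1 + 7 / real n) ^ n \<le> exp (7 / real n) ^ n"
    by (intro power_mono exp_ge_add_one_self) auto
  also have "\<dots> = exp 7" using n by (simp flip: exp_of_nat_mult)
  finally show ?thesis by simp
qed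

section \<open>Code lengths for the colorings of a block\<close>

definition block :: "nat \<Rightarrow> nat set \<Rightarrow> nat set set" where
  "block n w = (\<lambda>(i, j). flip j (flip i w)) ` ({..<n} \<times> {..<n})"

definition block_types :: "nat \<Rightarrow> (nat set \<Rightarrow> nat) \<Rightarrow> nat set \<Rightarrow> nat \<Rightarrow> nat set" where
  "block_types n g w = (\<lambda>i\<in>{..<n}. nbr_colors n g (flip i w))"

text \<open>A code length in nats: \<open>ln 2\<close> per alike pair for the free choice there, and
  \<open>ln n / n\<close> per unlike pair for describing the types. The constant 11 absorbs the 3
  colors of \<open>w\<close> and the bound of \<open>type_vector_kraft\<close>, as
  \<open>3 * 8 * exp 7 \<le> exp 11\<close>.\<close>

definition block_length :: "nat \<Rightarrow> nat set \<Rightarrow> (nat set \<Rightarrow> nat) \<Rightarrow> real" where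
  "block_length n w g = 11 + real (card (alike_pairs n (block_types n g w))) * ln 2
     + real (card (unlike_pairs n (block_types n g w))) / real n * ln (real n)"

lemma blockI: "i < n \<Longrightarrow> j < n \<Longrightarrow> flip j (flip i w) \<in> block n w"
  by (force simp: block_def)

text \<open>All neighbors of \<open>w + e_i\<close> lie in the block, so the pattern on the block
  determines the types.\<close>

lemma block_types_restrict:
  "block_types n (restrict g (block n w)) w = block_types n g w"
proof -
  have "nbr_colors n (restrict g (block n w)) (flip i w) = nbr_colors n g (flip i w)"
      if "i < n" for i
    unfolding nbr_colors_def using that by (intro image_cong refl) (simp add: blockI)
  thus ?thesis unfolding block_types_def by (intro restrict_ext) simp
qed

lemma block_length_restrict:
  "block_length n w (restrict g (block n w)) = block_length n w g"
  by (simp add: block_length_def block_types_restrict)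

lemma nbr_colors_subset:
  assumes "cube_proper n g" "v \<subseteq> {..<n}"
  shows "nbr_colors n g v \<subseteq> {..<3} - {g v}"
proof
  fix a assume "a \<in> nbr_colors n g v"
  then obtain j where j: "j < n" "a = g (flip j v)" by (auto simp: nbr_colors_def)
  thus "a \<in> {..<3} - {g v}"
    using assms flip_subset[OF assms(2) j(1)] by (simp add: cube_proper_def)
qed

lemma card_nbr_colors:
  assumes "cube_proper n g" "v \<subseteq> {..<n}" "n > 0"
  shows "card (nbr_colors n g v) \<in> {1, 2}"
proof -
  have gv: "g v \<in> {..<3}" using assms(1,2) by (simp add: cube_proper_def)
  have "card (nbr_colors n g v) \<le> card ({..<3} - {g v})"
    using nbr_colors_subset[OF assms(1,2)] by (intro card_mono) auto
  also have "\<dots> = 2" using gv by simp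
  finally have "card (nbr_colors n g v) \<le> 2" .
  moreover have "nbr_colors n g v \<noteq> {}" using assms(3) by (auto simp: nbr_colors_def)
  hence "card (nbr_colors n g v) > 0" by (simp add: nbr_colors_def card_gt_0_iff)
  ultimately show ?thesis by auto
qed

lemma block_types_props:
  assumes "cube_proper n g" "w \<subseteq> {..<n}" "i < n"
  shows "card (block_types n g w i) \<in> {1, 2}" "g w \<in> block_types n g w i"
    "block_types n g w i \<subseteq> {..<3}"
proof -
  have sub: "flip i w \<subseteq> {..<n}" using assms flip_subset by blast
  show "card (block_types n g w i) \<in> {1, 2}"
    using card_nbr_colors[OF assms(1) sub] assms(3) by (simp add: block_types_def)
  show "block_types n g w i \<subseteq> {..<3}"
    using nbr_colors_subset[OF assms(1) sub] assms(3) by (auto simp: block_types_def)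
  have "g w \<in> nbr_colors n g (flip i w)"
    unfolding nbr_colors_def using assms(3) by (intro image_eqI[of _ _ i]) auto
  thus "g w \<in> block_types n g w i" using assms(3) by (simp add: block_types_def)
qed

lemma card_Int_types:
  assumes "card (A :: nat set) \<in> {1, 2}" "card B \<in> {1, 2}"
  shows "card (A \<inter> B) \<le> (if A = B \<and> card A = 2 then 2 else 1)"
proof (cases "A = B")
  case False
  have "card A \<noteq> 0" "card B \<noteq> 0" using assms by auto
  hence fin: "finite A" "finite B" by (simp_all add: card_eq_0_iff)
  have le: "card (A \<inter> B) \<le> card A" "card (A \<inter> B) \<le> card B" using fin by (simp_all add: card_mono)
  have "card (A \<inter> B) \<le> 1"
  proof (rule ccontr)
    assume "\<not> card (A \<inter> B) \<le> 1"
    hence "card (A \<inter> B) = card A" "card (A \<inter> B) = card B" using le assms by auto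
    hence "A \<inter> B = A" "A \<inter> B = B"
      using card_subset_eq[OF fin(1) Int_lower1] card_subset_eq[OF fin(2) Int_lower2] by auto
    thus False using False by simp
  qed
  thus ?thesis using False by simp
qed (use assms in auto)

text \<open>The vertex \<open>w + e_i + e_j\<close> is adjacent to both \<open>w + e_i\<close> and
  \<open>w + e_j\<close>, so its color lies in \<open>\<tau> i \<inter> \<tau> j\<close>, which has
  two elements only for alike pairs. The factor 3 is for the color of \<open>w\<close>.\<close>

lemma card_block_patterns_of_type:
  assumes w: "w \<subseteq> {..<n}" and n: "n > 0"
  shows "card {x. \<exists>g. cube_proper n g \<and> x = restrict g (block n w) \<and> block_types n g w = \<tau>}
      \<le> 3 * 2 ^ card (alike_pairs n \<tau>)" (is "card ?X \<le> _")
    and "finite {x. \<exists>g. cube_proper n g \<and> x = restrict g (block n w) \<and> block_types n g w = \<tau>}"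
proof -
  have "card ?X \<le> 3 * 2 ^ card (alike_pairs n \<tau>) \<and> finite ?X"
  proof (cases "?X = {}")
    case True
    show ?thesis unfolding True by simp
  next
    case False
    \<comment> \<open>Any coloring realizing \<tau> shows that its entries have one or two
      elements.\<close>
    then obtain g\<^sub>0 where g\<^sub>0: "cube_proper n g\<^sub>0" "block_types n g\<^sub>0 w = \<tau>" by auto
    have \<tau>: "card (\<tau> i) \<in> {1, 2}" "finite (\<tau> i)" if "i < n" for i
      using block_types_props[OF g\<^sub>0(1) w that] g\<^sub>0(2) finite_subset by auto
    let ?Y = "{..<3::nat} \<times> (\<Pi>\<^sub>E p\<in>pairs n. \<tau> (fst p) \<inter> \<tau> (snd p))"
    let ?\<phi> = "\<lambda>x. (x w, \<lambda>p\<in>pairs n. x (flip (snd p) (flip (fst p) w)) :: nat)"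
    have fin: "finite ?Y"
      using \<tau>(2) by (intro finite_cartesian_product finite_PiE finite_pairs) (auto simp: pairs_def)
    have inj: "inj_on ?\<phi> ?X"
    proof (rule inj_onI, clarify)
      fix g h assume eqs: "restrict g (block n w) w = restrict h (block n w) w"
        "(\<lambda>p\<in>pairs n. restrict g (block n w) (flip (snd p) (flip (fst p) w)))
          = (\<lambda>p\<in>pairs n. restrict h (block n w) (flip (snd p) (flip (fst p) w)))"
      have lt: "g (flip j (flip i w)) = h (flip j (flip i w))" if "i < j" "j < n" for i j
        using fun_cong[OF eqs(2), of "(i, j)"] that by (simp add: pairs_def blockI)
      have "w \<in> block n w" using blockI[of 0 n 0 w] n by simp
      hence diag: "g w = h w" using eqs(1) by simp
      show "restrict g (block n w) = restrict h (block n w)"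
      proof (rule restrict_ext)
        fix y assume "y \<in> block n w"
        then obtain i j where ij: "i < n" "j < n" "y = flip j (flip i w)" by (auto simp: block_def)
        show "g y = h y"
          using lt[of i j] lt[of j i] diag ij
          by (cases i j rule: linorder_cases) (auto simp: flip_commute)
      qed
    qed
    have img: "?\<phi> ` ?X \<subseteq> ?Y"
    proof clarify
      fix g assume g: "cube_proper n g" and t: "\<tau> = block_types n g w"
      have wb: "w \<in> block n w" using blockI[of 0 n 0 w] n by simp
      have "g w < 3" using g w by (simp add: cube_proper_def)
      moreover have "g (flip j (flip i w)) \<in> block_types n g w i \<inter> block_types n g w j"
          if "i < n" "j < n" for i j
        using that by (auto simp: block_types_def nbr_colors_def flip_commute)
      ultimately show "restrict g (block n w) w \<in> {..<3} \<and>
          (\<lambda>p\<in>pairs n. restrict g (block n w) (flip (snd p) (flip (fst p) w)))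
            \<in> (\<Pi>\<^sub>E p\<in>pairs n. block_types n g w (fst p) \<inter> block_types n g w (snd p))"
        using wb by (auto simp: pairs_def blockI)
    qed
    have "card ?X \<le> card ?Y" by (rule card_inj_on_le[OF inj img fin])
    also have "\<dots> = 3 * (\<Prod>p\<in>pairs n. card (\<tau> (fst p) \<inter> \<tau> (snd p)))"
      by (simp add: card_cartesian_product card_PiE)
    also have "\<dots> \<le> 3 * (\<Prod>p\<in>pairs n. if \<tau> (fst p) = \<tau> (snd p) \<and> card (\<tau> (fst p)) = 2 then 2 else 1)"
    proof (intro mult_le_mono2 prod_mono conjI)
      fix p assume "p \<in> pairs n"
      hence "fst p < n" "snd p < n" by (auto simp: pairs_def)
      thus "card (\<tau> (fst p) \<inter> \<tau> (snd p)) \<le> (if \<tau> (fst p) = \<tau> (snd p)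
          \<and> card (\<tau> (fst p)) = 2 then 2 else 1)"
        by (intro card_Int_types \<tau>(1))
    qed simp
    also have "\<dots> = 3 * 2 ^ card (alike_pairs n \<tau>)"
      by (simp add: prod.If_cases alike_pairs_def Int_def split_def)
    finally have "card ?X \<le> 3 * 2 ^ card (alike_pairs n \<tau>)" .
    thus ?thesis using inj_on_finite[OF inj img fin] by blast
  qed
  thus "card ?X \<le> 3 * 2 ^ card (alike_pairs n \<tau>)" "finite ?X" by auto
qed

text \<open>24 is the product of the 3 and the 8 in \<open>block_kraft\<close>; the same bound later
  absorbs the factor 10 of \<open>mixing_time_ge\<close>.\<close>

lemma exp_4_ge: "24 \<le> exp (4::real)"
proof -
  have "(1 + (1/2::real)) ^ 8 \<le> exp (1/2) ^ 8"
    by (intro power_mono exp_ge_add_one_self) auto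
  also have "\<dots> = exp (4::real)" by (simp flip: exp_of_nat_mult)
  finally show ?thesis by (simp add: power_divide)
qed

text \<open>Group the patterns by type vector: a vector with \<open>a\<close> alike pairs has at
  most \<open>3 * 2 ^ a\<close> patterns, each of weight \<open>exp (- 11) / 2 ^ a\<close> times the
  weight of the vector, and \<open>type_vector_kraft\<close> sums the latter.\<close>

lemma block_kraft:
  assumes w: "w \<subseteq> {..<n}" and n: "n > 0" and fin: "finite X"
    and X: "\<And>x. x \<in> X \<Longrightarrow> \<exists>g. cube_proper n g \<and> x = restrict g (block n w)"
  shows "(\<Sum>x\<in>X. exp (- block_length n w x)) \<le> 1"
proof -
  let ?T = "{..<n} \<rightarrow>\<^sub>E Pow {..<3::nat}"
  let ?ty = "\<lambda>x. block_types n x w"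
  have ty: "?ty ` X \<subseteq> ?T"
  proof clarify
    fix x assume "x \<in> X"
    then obtain g where g: "cube_proper n g" "x = restrict g (block n w)" using X by blast
    show "?ty x \<in> ?T"
      using block_types_props(3)[OF g(1) w] unfolding g(2) block_types_restrict
      by (auto simp: block_types_def PiE_iff extensional_def)
  qed
  have "(\<Sum>x\<in>X. exp (- block_length n w x)) = (\<Sum>\<tau>\<in>?T. \<Sum>x\<in>{x \<in> X. ?ty x
      = \<tau>}. exp (- block_length n w x))"
    using ty fin by (intro sum.group[symmetric] finite_PiE) auto
  also have "\<dots> \<le> (\<Sum>\<tau>\<in>?T. 3 * exp (- 11) * exp (- (real (card (unlike_pairs n \<tau>)) / real n
      * ln (real n))))"
  proof (rule sum_mono)
    fix \<tau>
    let ?X = "{x. \<exists>g. cube_proper n g \<and> x = restrict g (block n w) \<and> block_types n g w = \<tau>}"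
    let ?u = "exp (- (real (card (unlike_pairs n \<tau>)) / real n * ln (real n)))"
    let ?a = "card (alike_pairs n \<tau>)"
    have "{x \<in> X. ?ty x = \<tau>} \<subseteq> ?X"
    proof clarify
      fix x assume "x \<in> X"
      then obtain g where "cube_proper n g" "x = restrict g (block n w)" using X by blast
      thus "\<exists>g. cube_proper n g \<and> x = restrict g (block n w) \<and> block_types n g w = ?ty x"
        by (metis block_types_restrict)
    qed
    hence "card {x \<in> X. ?ty x = \<tau>} \<le> 3 * 2 ^ ?a"
      using card_block_patterns_of_type[OF w n, of \<tau>] by (meson card_mono le_trans)
    hence card: "real (card {x \<in> X. ?ty x = \<tau>}) \<le> 3 * 2 ^ ?a"
      by (metis (mono_tags, lifting) of_nat_le_iff of_nat_mult of_nat_numeral of_nat_power)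
    have "(\<Sum>x\<in>{x \<in> X. ?ty x = \<tau>}. exp (- block_length n w x))
        = (\<Sum>x\<in>{x \<in> X. ?ty x = \<tau>}. exp (- 11) * (1 / 2 ^ ?a) * ?u)"
    proof (rule sum.cong[OF refl])
      fix x assume "x \<in> {x \<in> X. ?ty x = \<tau>}"
      hence "- block_length n w x
          = - 11 + (- (real ?a * ln 2)) + (- (real (card (unlike_pairs n \<tau>)) / real n * ln (real
          n)))"
        by (simp add: block_length_def)
      hence "exp (- block_length n w x) = exp (- 11) * exp (- (real ?a * ln 2)) * ?u"
        by (simp only: exp_add)
      also have "exp (- (real ?a * ln 2)) = (1 / 2 ^ ?a :: real)"
        by (simp add: exp_minus exp_of_nat_mult inverse_eq_divide)
      finally show "exp (- block_length n w x) = exp (- 11) * (1 / 2 ^ ?a) * ?u" .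
    qed
    also have "\<dots> = real (card {x \<in> X. ?ty x = \<tau>}) * (exp (- 11) * (1 / 2 ^ ?a) * ?u)" by simp
    also have "\<dots> \<le> (3 * 2 ^ ?a) * (exp (- 11) * (1 / 2 ^ ?a) * ?u)"
      using card by (intro mult_right_mono) auto
    finally show "(\<Sum>x\<in>{x \<in> X. ?ty x = \<tau>}. exp (- block_length n w x)) \<le> 3 * exp (- 11) * ?u" by simp
  qed
  also have "\<dots> = 3 * exp (- 11) * (\<Sum>\<tau>\<in>?T. exp (- (real (card (unlike_pairs n \<tau>)) / real n
      * ln (real n))))"
    by (simp add: sum_distrib_left)
  also have "\<dots> \<le> 3 * exp (- 11) * (8 * exp 7)"
    by (intro mult_left_mono type_vector_kraft n) auto
  also have "\<dots> = 24 * exp (- 4)" by (simp flip: exp_add)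
  also have "\<dots> \<le> 1" using exp_4_ge by (simp add: exp_minus field_simps)
  finally show ?thesis .
qed

section \<open>Counting balanced colorings of the hypercube\<close>

definition free_even :: "nat \<Rightarrow> (nat set \<Rightarrow> nat) \<Rightarrow> nat" where
  "free_even n g = card {v \<in> even_verts n. card (nbr_colors n g v) = 1}"

lemma even_verts_subset: "v \<in> even_verts n \<Longrightarrow> v \<subseteq> {..<n}"
  and odd_verts_subset: "v \<in> odd_verts n \<Longrightarrow> v \<subseteq> {..<n}"
  by (simp_all add: even_verts_def odd_verts_def)

text \<open>Given the odd colors, an even vertex can only take a color missing from its type: two
  choices for a singleton type, one otherwise.\<close>

lemma card_fiber_odd_colors:
  assumes fin: "finite \<Omega>" and n: "n > 0" and \<omega>: "\<omega> \<in> \<Omega>"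
    and proper: "\<And>\<omega>. \<omega> \<in> \<Omega> \<Longrightarrow> cube_proper n (c \<omega>)"
    and inj: "\<And>\<omega> \<omega>'. \<omega> \<in> \<Omega> \<Longrightarrow> \<omega>' \<in> \<Omega> \<Longrightarrow> (\<And>X. X \<subseteq> {..<n} \<Longrightarrow> c \<omega> X = c \<omega>' X) \<Longrightarrow> \<omega> = \<omega>'"
  shows "card (fiber \<Omega> (\<lambda>\<omega>. restrict (c \<omega>) (odd_verts n)) \<omega>) \<le> 2 ^ free_even n (c \<omega>)"
proof -
  let ?F = "fiber \<Omega> (\<lambda>\<omega>. restrict (c \<omega>) (odd_verts n)) \<omega>"
  let ?E = "even_verts n"
  let ?Y = "\<Pi>\<^sub>E v\<in>?E. {..<3} - nbr_colors n (c \<omega>) v"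
  have odd: "c \<omega>' x = c \<omega> x" if "\<omega>' \<in> ?F" "x \<in> odd_verts n" for \<omega>' x
    using that unfolding fiber_def by (metis (mono_tags, lifting) mem_Collect_eq restrict_apply')
  have F: "\<omega>' \<in> \<Omega>" if "\<omega>' \<in> ?F" for \<omega>' using that by (simp add: fiber_def)
  have "inj_on (\<lambda>\<omega>'. restrict (c \<omega>') ?E) ?F"
  proof (rule inj_onI)
    fix \<omega>1 \<omega>2 assume \<omega>: "\<omega>1 \<in> ?F" "\<omega>2 \<in> ?F" and eq: "restrict (c \<omega>1) ?E = restrict (c \<omega>2) ?E"
    show "\<omega>1 = \<omega>2"
    proof (rule inj)
      fix X assume X: "X \<subseteq> {..<n}"
      show "c \<omega>1 X = c \<omega>2 X"
      proof (cases "X \<in> ?E")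
        case True
        thus ?thesis using fun_cong[OF eq, of X] by simp
      next
        case False
        hence "X \<in> odd_verts n" using X by (simp add: even_verts_def odd_verts_def)
        thus ?thesis using odd \<omega> by simp
      qed
    qed (use \<omega> F in auto)
  qed
  moreover have "(\<lambda>\<omega>'. restrict (c \<omega>') ?E) ` ?F \<subseteq> ?Y"
  proof (rule image_subsetI)
    fix \<omega>' assume \<omega>': "\<omega>' \<in> ?F"
    have "c \<omega>' v \<in> {..<3} - nbr_colors n (c \<omega>) v" if v: "v \<in> ?E" for v
    proof -
      have "nbr_colors n (c \<omega>') v = nbr_colors n (c \<omega>) v"
        unfolding nbr_colors_def using odd[OF \<omega>'] flip_even[OF v] by (intro image_cong refl) auto
      moreover have "c \<omega>' v \<in> {..<3}"
        using proper[OF F[OF \<omega>']] even_verts_subset[OF v] by (simp add: cube_proper_def)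
      ultimately show ?thesis
        using nbr_colors_subset[OF proper[OF F[OF \<omega>']] even_verts_subset[OF v]] by auto
    qed
    thus "restrict (c \<omega>') ?E \<in> ?Y" by (intro restrict_PiE_iff[THEN iffD2] ballI)
  qed
  moreover have "finite ?Y" by (intro finite_PiE) auto
  ultimately have "card ?F \<le> card ?Y" by (rule card_inj_on_le)
  also have "\<dots> = (\<Prod>v\<in>?E. card ({..<3} - nbr_colors n (c \<omega>) v))" by (simp add: card_PiE)
  also have "\<dots> \<le> (\<Prod>v\<in>?E. if card (nbr_colors n (c \<omega>) v) = 1 then 2 else 1)"
  proof (intro prod_mono conjI)
    fix v assume v: "v \<in> ?E"
    have "nbr_colors n (c \<omega>) v \<subseteq> {..<3}"
      using nbr_colors_subset[OF proper[OF \<omega>] even_verts_subset[OF v]] by auto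
    hence "card ({..<3} - nbr_colors n (c \<omega>) v) = 3 - card (nbr_colors n (c \<omega>) v)"
      by (subst card_Diff_subset) (auto intro: finite_subset)
    thus "card ({..<3} - nbr_colors n (c \<omega>) v) \<le> (if card (nbr_colors n (c \<omega>) v) = 1 then 2 else 1)"
      using card_nbr_colors[OF proper[OF \<omega>] even_verts_subset[OF v] n] by auto
  qed simp
  also have "\<dots> = 2 ^ free_even n (c \<omega>)"
    by (simp add: prod.If_cases free_even_def Int_def)
  finally show ?thesis .
qed

text \<open>\<open>x\<close> lies in the block of \<open>x + e_i + e_j\<close>, and distinct pairs
  \<open>i < j\<close> give distinct centres.\<close>

lemma block_cover:
  assumes x: "x \<in> odd_verts n"
  shows "card (pairs n) \<le> card {w \<in> odd_verts n. x \<in> block n w}"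
proof (rule card_inj_on_le)
  let ?g = "\<lambda>(i, j). flip i (flip j x)"
  show "?g ` pairs n \<subseteq> {w \<in> odd_verts n. x \<in> block n w}"
  proof clarify
    fix i j assume "(i, j) \<in> pairs n"
    hence ij: "i < n" "j < n" by (auto simp: pairs_def)
    have "flip i (flip j x) \<in> odd_verts n" using x ij by (intro flip_even flip_odd)
    moreover have "x \<in> block n (flip i (flip j x))"
      using blockI[OF ij, of "flip i (flip j x)"] by simp
    ultimately show "flip i (flip j x) \<in> odd_verts n \<and> x \<in> block n (flip i (flip j x))" by blast
  qed
  show "inj_on ?g (pairs n)"
  proof (rule inj_onI, clarify)
    fix i j k l assume ij: "(i, j) \<in> pairs n" "(k, l) \<in> pairs n"
      and eq: "flip i (flip j x) = flip k (flip l x)"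
    have mem: "y \<in> flip i (flip j x) \<longleftrightarrow> (y \<in> x) \<noteq> (y = i \<or> y = j)" if "i < j" for y i j
      using that by (auto simp: flip_def)
    have "y = i \<or> y = j \<longleftrightarrow> y = k \<or> y = l" for y
      using mem[of i j y] mem[of k l y] ij eq by (auto simp: pairs_def)
    hence "i = k \<or> i = l" "j = k \<or> j = l" "k = i \<or> k = j" by blast+
    thus "i = k \<and> j = l" using ij by (auto simp: pairs_def)
  qed
qed simp

text \<open>Chain rule along the odd colors: \<open>card_fiber_odd_colors\<close> bounds the fibers,
  Shearer bounds the entropy of the odd colors by that of the blocks, and each block has entropy at
  most its mean code length. All terms are averages over \<Omega>, so the pointwise bound by
  \<open>M\<close> suffices.\<close>

lemma ln_card_le_of_block_lengths:
  assumes fin: "finite \<Omega>" and ne: "\<Omega> \<noteq> {}" and n: "n \<ge> 2"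
    and proper: "\<And>\<omega>. \<omega> \<in> \<Omega> \<Longrightarrow> cube_proper n (c \<omega>)"
    and inj: "\<And>\<omega> \<omega>'. \<omega> \<in> \<Omega> \<Longrightarrow> \<omega>' \<in> \<Omega> \<Longrightarrow> (\<And>X. X \<subseteq> {..<n} \<Longrightarrow> c \<omega> X = c \<omega>' X) \<Longrightarrow> \<omega> = \<omega>'"
    and bound: "\<And>\<omega>. \<omega> \<in> \<Omega> \<Longrightarrow> real (free_even n (c \<omega>)) * ln 2
      + (\<Sum>w\<in>odd_verts n. block_length n w (c \<omega>)) / real (card (pairs n)) \<le> M"
  shows "ln (real (card \<Omega>)) \<le> M"
proof -
  let ?O = "odd_verts n" and ?m = "real (card (pairs n))" and ?N = "real (card \<Omega>)"
  let ?odd = "\<lambda>\<omega>. restrict (c \<omega>) ?O"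
  have n0: "n > 0" using n by simp
  have "(0, 1) \<in> pairs n" using n by (auto simp: pairs_def)
  hence m: "?m > 0" by (auto simp: card_gt_0_iff)
  have N: "?N > 0" using fin ne by (simp add: card_gt_0_iff)
  have sub: "block n w \<subseteq> ?O" if "w \<in> ?O" for w
    using that by (auto simp: block_def intro!: flip_even flip_odd)
  have blk: "entropy \<Omega> (\<lambda>\<omega>. restrict (c \<omega>) (block n w)) \<le> (\<Sum>\<omega>\<in>\<Omega>. block_length n w (c \<omega>)) / ?N"
    if w: "w \<in> ?O" for w
  proof -
    let ?X = "\<lambda>\<omega>. restrict (c \<omega>) (block n w)"
    have "(\<Sum>x\<in>?X ` \<Omega>. exp (- block_length n w x)) \<le> 1"
      using fin proper by (intro block_kraft odd_verts_subset[OF w] n0) auto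
    hence "entropy \<Omega> ?X \<le> (\<Sum>\<omega>\<in>\<Omega>. block_length n w (?X \<omega>)) / ?N"
      by (rule entropy_le_expected_length[OF fin])
    thus ?thesis by (simp only: block_length_restrict)
  qed
  have "?m * entropy \<Omega> ?odd \<le> (\<Sum>w\<in>?O. entropy \<Omega> (\<lambda>\<omega>. restrict (c \<omega>) (block n w)))"
    by (rule shearer[OF fin _ _ sub block_cover]) auto
  also have "\<dots> \<le> (\<Sum>w\<in>?O. (\<Sum>\<omega>\<in>\<Omega>. block_length n w (c \<omega>)) / ?N)"
    by (intro sum_mono blk)
  also have "\<dots> = (\<Sum>\<omega>\<in>\<Omega>. \<Sum>w\<in>?O. block_length n w (c \<omega>)) / ?N"
    by (subst sum.swap) (simp add: sum_divide_distrib)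
  finally have "entropy \<Omega> ?odd \<le> (\<Sum>\<omega>\<in>\<Omega>. \<Sum>w\<in>?O. block_length n w (c \<omega>)) / ?N / ?m"
    using m by (simp add: pos_le_divide_eq mult.commute del: divide_divide_eq_left
    of_nat_0_less_iff)
  also have "\<dots> = (\<Sum>\<omega>\<in>\<Omega>. (\<Sum>w\<in>?O. block_length n w (c \<omega>)) / ?m) / ?N"
    by (simp add: mult.commute flip: sum_divide_distrib)
  finally have H: "entropy \<Omega> ?odd \<le> (\<Sum>\<omega>\<in>\<Omega>. (\<Sum>w\<in>?O. block_length n w (c \<omega>)) / ?m) / ?N" .
  have fib: "ln (real (card (fiber \<Omega> ?odd \<omega>))) \<le> real (free_even n (c \<omega>)) * ln 2"
      if \<omega>: "\<omega> \<in> \<Omega>" for \<omega>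
  proof -
    have "card (fiber \<Omega> ?odd \<omega>) \<le> 2 ^ free_even n (c \<omega>)"
      by (rule card_fiber_odd_colors[OF fin n0 \<omega> proper inj])
    hence "real (card (fiber \<Omega> ?odd \<omega>)) \<le> 2 ^ free_even n (c \<omega>)"
      by (metis of_nat_le_iff of_nat_numeral of_nat_power)
    hence "ln (real (card (fiber \<Omega> ?odd \<omega>))) \<le> ln (2 ^ free_even n (c \<omega>))"
      using card_fiber_pos[OF fin \<omega>, of ?odd] by (subst ln_le_cancel_iff) auto
    thus ?thesis by (simp add: ln_realpow)
  qed
  have "ln ?N = entropy \<Omega> ?odd + (\<Sum>\<omega>\<in>\<Omega>. ln (real (card (fiber \<Omega> ?odd \<omega>)))) / ?N"
    by (rule ln_card_eq_entropy[OF fin ne])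
  also have "\<dots> \<le> (\<Sum>\<omega>\<in>\<Omega>. (\<Sum>w\<in>?O. block_length n w (c \<omega>)) / ?m) / ?N
      + (\<Sum>\<omega>\<in>\<Omega>. real (free_even n (c \<omega>)) * ln 2) / ?N"
    using fib by (intro add_mono H divide_right_mono sum_mono) auto
  also have "\<dots> = (\<Sum>\<omega>\<in>\<Omega>. real (free_even n (c \<omega>)) * ln 2
      + (\<Sum>w\<in>?O. block_length n w (c \<omega>)) / ?m) / ?N"
    by (simp add: sum.distrib add_divide_distrib)
  also have "\<dots> \<le> (\<Sum>\<omega>\<in>\<Omega>. M) / ?N"
    using bound by (intro divide_right_mono sum_mono) auto
  also have "\<dots> = M" using N by simp
  finally show ?thesis .
qed

text \<open>A free even vertex accounts for one bit. By \<open>alike_unlike_bound\<close> the alike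
  pairs of all blocks, divided by \<open>card (pairs n)\<close>, account for at most one bit per
  remaining even vertex, less a quarter bit for each unlike pair, likewise divided. So an unlike
  pair saves \<open>ln 2 / 4\<close> and costs only \<open>ln n / n\<close>.\<close>

lemma total_block_length_le:
  assumes g: "cube_proper n g" and n: "n \<ge> 2"
  shows "real (free_even n g) * ln 2 + (\<Sum>w\<in>odd_verts n. block_length n w g) / real (card (pairs n))
    \<le> real (card (even_verts n)) * ln 2
      + (\<Sum>w\<in>odd_verts n. 11 - real (card (unlike_pairs n (block_types n g w))) * (ln 2 / 4 - ln
      (real n) / real n))
        / real (card (pairs n))"
proof -
  let ?O = "odd_verts n" and ?E = "even_verts n" and ?m = "real (card (pairs n))"
  let ?e = "\<lambda>w. real (card (alike_pairs n (block_types n g w)))"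
  let ?u = "\<lambda>w. real (card (unlike_pairs n (block_types n g w)))"
  let ?B = "{v \<in> ?E. card (nbr_colors n g v) = 2}"
  let ?Z = "\<lambda>w. card {i. i < n \<and> card (block_types n g w i) = 2}"
  have m: "2 * ?m = real n * real (n - 1)" using arg_cong[OF card_pairs[of n], of real] by simp
  have p01: "(0, 1) \<in> pairs n" using n by (auto simp: pairs_def)
  hence m0: "?m > 0" by (auto simp: card_gt_0_iff)
  \<comment> \<open>Double counting: in each direction \<open>i\<close>, an even vertex with a
    two-element type is \<open>w + e_i\<close> for exactly one odd \<open>w\<close>.\<close>
  have "(\<Sum>w\<in>?O. ?Z w) = (\<Sum>w\<in>?O. \<Sum>i<n. if card (nbr_colors n g (flip i w)) = 2 then 1 else 0)"
    by (intro sum.cong refl) (simp add: sum.If_cases Int_def block_types_def cong: conj_cong)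
  also have "\<dots> = (\<Sum>i<n. \<Sum>w\<in>?O. if card (nbr_colors n g (flip i w)) = 2 then 1 else 0)"
    by (rule sum.swap)
  also have "\<dots> = (\<Sum>i<n. card ?B)"
  proof (rule sum.cong[OF refl])
    fix i assume i: "i \<in> {..<n}"
    have "bij_betw (flip i) {w \<in> ?O. card (nbr_colors n g (flip i w)) = 2} ?B"
      using i by (intro bij_betwI[where g = "flip i"]) (auto intro: flip_even flip_odd)
    thus "(\<Sum>w\<in>?O. if card (nbr_colors n g (flip i w)) = 2 then 1 else 0) = card ?B"
      by (simp add: sum.If_cases Int_def bij_betw_same_card)
  qed
  finally have Z: "(\<Sum>w\<in>?O. ?Z w) = n * card ?B" by simp
  have "?E = ?B \<union> {v \<in> ?E. card (nbr_colors n g v) = 1}"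
    using card_nbr_colors[OF g even_verts_subset] n by auto
  moreover have "card (?B \<union> {v \<in> ?E. card (nbr_colors n g v) = 1}) = card ?B + free_even n g"
    unfolding free_even_def by (intro card_Un_disjoint) auto
  ultimately have EB: "card ?E = card ?B + free_even n g" by simp
  have "4 * ?e w + ?u w \<le> 2 * real (n - 1) * real (?Z w)" if w: "w \<in> ?O" for w
  proof -
    have "4 * card (alike_pairs n (block_types n g w)) + card (unlike_pairs n (block_types n g w))
        \<le> 2 * (n - 1) * ?Z w"
      using block_types_props[OF g odd_verts_subset[OF w]] by (intro alike_unlike_bound) auto
    hence "real (4 * card (alike_pairs n (block_types n g w))
        + card (unlike_pairs n (block_types n g w)))
        \<le> real (2 * (n - 1) * ?Z w)" by (rule of_nat_mono)
    thus ?thesis by simp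
  qed
  hence "(\<Sum>w\<in>?O. 4 * ?e w + ?u w) \<le> (\<Sum>w\<in>?O. 2 * real (n - 1) * real (?Z w))"
    by (rule sum_mono)
  also have "\<dots> = 2 * real (n - 1) * real (n * card ?B)"
      by (simp add: Z flip: sum_distrib_left of_nat_sum)
  also have "\<dots> = 4 * ?m * real (card ?B)" using m by simp
  finally have "(\<Sum>w\<in>?O. ?e w + ?u w / 4) \<le> ?m * real (card ?B)"
    by (simp add: sum.distrib flip: sum_distrib_left sum_divide_distrib)
  hence "(\<Sum>w\<in>?O. ?e w + ?u w / 4) * ln 2 \<le> ?m * real (card ?B) * ln 2"
    by (intro mult_right_mono) auto
  moreover have "(\<Sum>w\<in>?O. block_length n w g)
      = (\<Sum>w\<in>?O. 11 - ?u w * (ln 2 / 4 - ln (real n) / real n)) + (\<Sum>w\<in>?O. ?e w + ?u w / 4) * ln 2"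
    unfolding sum_distrib_right sum.distrib[symmetric] block_length_def
    by (intro sum.cong refl) (simp add: algebra_simps)
  ultimately have "(\<Sum>w\<in>?O. block_length n w g) / ?m
      \<le> ((\<Sum>w\<in>?O. 11 - ?u w * (ln 2 / 4 - ln (real n) / real n)) + ?m * real (card ?B) * ln 2) / ?m"
    using m0 by (intro divide_right_mono) auto
  also have "\<dots> = (\<Sum>w\<in>?O. 11 - ?u w * (ln 2 / 4 - ln (real n) / real n)) / ?m
      + real (card ?B) * ln 2"
    using p01 by (auto simp: add_divide_distrib)
  finally show ?thesis using EB by (simp add: algebra_simps)
qed

definition zero_set :: "nat \<Rightarrow> (nat set \<Rightarrow> nat) \<Rightarrow> nat set set" where
  "zero_set n g = {v \<in> even_verts n. nbr_colors n g v = {0}}"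

text \<open>Neighbors of \<open>w\<close> on different sides of the zero set have different types,
  so isoperimetry yields unlike pairs, in abundance because the zero set and its complement each
  hold a constant fraction of the even vertices.\<close>

lemma sum_unlike_ge:
  assumes n: "n \<ge> 2"
    and lower: "card (even_verts n) < 2 * card (zero_set n g)"
    and upper: "2 * card (zero_set n g) \<le> card (even_verts n) + 2 * n"
    and large: "4 * n \<le> card (even_verts n)"
  shows "n * card (even_verts n) \<le> 2 * (\<Sum>w\<in>odd_verts n. card (unlike_pairs n (block_types n g w)))"
proof -
  let ?S = "zero_set n g" and ?E = "even_verts n"
  let ?U = "\<Sum>w\<in>odd_verts n. card (unlike_pairs n (block_types n g w))"
  have S: "?S \<subseteq> ?E" by (auto simp: zero_set_def)
  have E: "card ?E = 2 * 2 ^ (n - 2)"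
    using card_parity_verts(1)[of n] n by (cases n; cases "n - 1") auto
  have "card (?E - ?S) = card ?E - card ?S"
      using S by (intro card_Diff_subset) (auto intro: finite_subset)
  \<comment> \<open>By \<open>upper\<close> and \<open>large\<close>,
    \<open>4 * card ?S \<le> 2 * card ?E + 4 * n \<le> 3 * card ?E\<close>.\<close>
  hence "4 * card (?E - ?S) \<ge> card ?E" using upper large by simp
  hence "(2 * card ?S) * (4 * card (?E - ?S)) \<ge> card ?E * card ?E"
    using lower by (intro mult_le_mono) auto
  hence "n * (card ?E * card ?E) \<le> 4 * (n * (2 * card ?S * card (?E - ?S)))" by simp
  also have "n * (2 * card ?S * card (?E - ?S)) \<le> 2 ^ (n - 2) *
      (\<Sum>w\<in>odd_verts n. card {(i, j). i < n \<and> j < n \<and> (flip i w \<in> ?S) \<noteq> (flip j w \<in> ?S)})"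
    by (rule cut_isoperimetry[OF S])
  also have "(\<Sum>w\<in>odd_verts n. card {(i, j). i < n \<and> j < n
      \<and> (flip i w \<in> ?S) \<noteq> (flip j w \<in> ?S)}) \<le> ?U"
  proof (rule sum_mono)
    fix w assume w: "w \<in> odd_verts n"
    have mem: "flip i w \<in> ?S \<longleftrightarrow> block_types n g w i = {0}" if "i < n" for i
      using flip_odd[OF w that] that by (simp add: zero_set_def block_types_def)
    have "{(i, j). i < n \<and> j < n \<and> (flip i w \<in> ?S) \<noteq> (flip j w \<in> ?S)}
        \<subseteq> unlike_pairs n (block_types n g w)"
      using mem by (fastforce simp: unlike_pairs_def)
    thus "card {(i, j). i < n \<and> j < n \<and> (flip i w \<in> ?S) \<noteq> (flip j w \<in> ?S)}
        \<le> card (unlike_pairs n (block_types n g w))"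
      by (rule card_mono[OF finite_unlike_pairs])
  qed
  finally have "card ?E * (n * card ?E) \<le> card ?E * (2 * ?U)" using E by (simp add: algebra_simps)
  moreover have "card ?E > 0" using E by simp
  ultimately show ?thesis by simp
qed

text \<open>Write E for the number of even vertices. Each unlike pair saves at least
  \<open>1/8 - 1/40 = 1/10\<close>, so the at least \<open>n * E / 2\<close> of them save
  \<open>n * E / 20\<close>. For \<open>n \<ge> 440\<close> half of this outweighs the
  \<open>11 * E\<close> of the block constants; the other half, divided by
  \<open>card (pairs n) \<le> n^2 / 2\<close>, leaves \<open>E / (20 * n)\<close>.\<close>

lemma ln_card_balanced_le:
  assumes fin: "finite \<Omega>" and ne: "\<Omega> \<noteq> {}" and n: "n \<ge> 440" "ln (real n) / real n \<le> 1 / 40"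
    and large: "4 * n \<le> card (even_verts n)"
    and proper: "\<And>\<omega>. \<omega> \<in> \<Omega> \<Longrightarrow> cube_proper n (c \<omega>)"
    and inj: "\<And>\<omega> \<omega>'. \<omega> \<in> \<Omega> \<Longrightarrow> \<omega>' \<in> \<Omega> \<Longrightarrow> (\<And>X. X \<subseteq> {..<n} \<Longrightarrow> c \<omega> X = c \<omega>' X) \<Longrightarrow> \<omega> = \<omega>'"
    and lower: "\<And>\<omega>. \<omega> \<in> \<Omega> \<Longrightarrow> card (even_verts n) < 2 * card (zero_set n (c \<omega>))"
    and upper: "\<And>\<omega>. \<omega> \<in> \<Omega> \<Longrightarrow> 2 * card (zero_set n (c \<omega>)) \<le> card (even_verts n) + 2 * n"
  shows "ln (real (card \<Omega>))
      \<le> real (card (even_verts n)) * ln 2 - real (card (even_verts n)) / (20 * real n)"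
proof (rule ln_card_le_of_block_lengths[OF fin ne _ proper inj])
  show n2: "n \<ge> 2" using n by simp
  fix \<omega> assume \<omega>: "\<omega> \<in> \<Omega>"
  let ?g = "c \<omega>" and ?O = "odd_verts n" and ?E = "real (card (even_verts n))" and ?m =
  "real (card (pairs n))"
  let ?u = "\<lambda>w. real (card (unlike_pairs n (block_types n ?g w)))"
  have "exp (1/2) \<le> (2::real)" using exp_bound[of "1/2"] by (simp add: power2_eq_square)
  hence "(ln 2 :: real) \<ge> 1/2" using ln_ge_iff[of 2 "1/2"] by simp
  hence c: "ln 2 / 4 - ln (real n) / real n \<ge> 1/10" using n(2) by simp
  have O: "card ?O = card (even_verts n)" using card_parity_verts[of n] n by simp
  have "real (n * card (even_verts n))
      \<le> real (2 * (\<Sum>w\<in>?O. card (unlike_pairs n (block_types n ?g w))))"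
    using sum_unlike_ge[OF n2 lower[OF \<omega>] upper[OF \<omega>] large] by (rule of_nat_mono)
  hence U: "real n * ?E \<le> 2 * (\<Sum>w\<in>?O. ?u w)" by simp
  have "(\<Sum>w\<in>?O. 11 - ?u w * (ln 2 / 4 - ln (real n) / real n)) \<le> (\<Sum>w\<in>?O. 11 - ?u w * (1/10))"
    using c by (intro sum_mono diff_left_mono mult_left_mono) auto
  also have "\<dots> = 11 * ?E - (\<Sum>w\<in>?O. ?u w) / 10"
    using O by (simp add: sum_subtractf sum_divide_distrib)
  also have "\<dots> \<le> 11 * ?E - real n * ?E / 20" using U by simp
  also have "\<dots> \<le> - (real n * ?E / 40)"
    using mult_right_mono[of 440 "real n" ?E] n by simp
  finally have le: "(\<Sum>w\<in>?O. 11 - ?u w * (ln 2 / 4 - ln (real n) / real n)) \<le> - (real n * ?E / 40)" .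
  have m: "2 * ?m = real n * real (n - 1)" using arg_cong[OF card_pairs[of n], of real] by simp
  hence m': "2 * ?m \<le> real n * real n" by (simp add: mult_left_mono)
  have "(0, 1) \<in> pairs n" using n by (auto simp: pairs_def)
  hence m0: "?m > 0" by (auto simp: card_gt_0_iff)
  have "(\<Sum>w\<in>?O. 11 - ?u w * (ln 2 / 4 - ln (real n) / real n)) / ?m \<le> - (real n * ?E / 40) / ?m"
    using m0 by (intro divide_right_mono le) auto
  also have "\<dots> \<le> - (?E / (20 * real n))"
  proof -
    have "?E * (2 * ?m) \<le> ?E * (real n * real n)" using m' by (intro mult_left_mono) auto
    thus ?thesis using m0 n by (simp add: field_simps)
  qed
  finally show "real (free_even n ?g) * ln 2 + (\<Sum>w\<in>?O. block_length n w ?g) / ?m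
      \<le> ?E * ln 2 - ?E / (20 * real n)"
    using total_block_length_le[OF proper[OF \<omega>] n2] by linarith
qed

section \<open>The torus with side 4\<close>

definition swap01 :: "nat \<Rightarrow> nat" where
  "swap01 a = (if a = 0 then 1 else if a = 1 then 0 else a)"

definition recolor :: "'v set \<Rightarrow> ('v \<Rightarrow> nat) \<Rightarrow> 'v \<Rightarrow> nat" where
  "recolor V \<chi> = (\<lambda>v\<in>V. swap01 (\<chi> v))"

lemma swap01_swap01 [simp]: "swap01 (swap01 a) = a"
  by (simp add: swap01_def)

lemma swap01_eq_iff [simp]: "swap01 a = swap01 b \<longleftrightarrow> a = b"
  by (metis swap01_swap01)

lemma C3_D:
  assumes "\<chi> \<in> C3 L d"
  shows "v \<in> torus_verts L d \<Longrightarrow> \<chi> v < 3" "v \<notin> torus_verts L d \<Longrightarrow> \<chi> v = undefined"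
    "torus_adj L d u v \<Longrightarrow> \<chi> u \<noteq> \<chi> v"
  using assms unfolding C3_def proper_colorings_def torus_adj_def
  by (auto simp: PiE_iff extensional_def)

lemma C3_I:
  assumes "\<And>v. v \<in> torus_verts L d \<Longrightarrow> \<chi> v < 3" "\<And>v. v \<notin> torus_verts L d \<Longrightarrow> \<chi> v = undefined"
    "\<And>u v. u \<in> torus_verts L d \<Longrightarrow> v \<in> torus_verts L d \<Longrightarrow> torus_adj L d u v \<Longrightarrow> \<chi> u \<noteq> \<chi> v"
  shows "\<chi> \<in> C3 L d"
  using assms unfolding C3_def proper_colorings_def by (auto simp: PiE_iff extensional_def)

lemma recolor_C3:
  assumes "\<chi> \<in> C3 L d"
  shows "recolor (torus_verts L d) \<chi> \<in> C3 L d"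
proof (rule C3_I)
  fix v assume "v \<in> torus_verts L d"
  thus "recolor (torus_verts L d) \<chi> v < 3"
      using C3_D(1)[OF assms] by (auto simp: recolor_def swap01_def)
next
  fix u v assume uv: "u \<in> torus_verts L d" "v \<in> torus_verts L d" "torus_adj L d u v"
  thus "recolor (torus_verts L d) \<chi> u \<noteq> recolor (torus_verts L d) \<chi> v"
    using C3_D(3)[OF assms uv(3)] by (simp add: recolor_def)
qed (simp add: recolor_def)

lemma recolor_recolor:
  assumes "\<chi> \<in> C3 L d"
  shows "recolor (torus_verts L d) (recolor (torus_verts L d) \<chi>) = \<chi>"
  using C3_D(2)[OF assms] by (auto simp: recolor_def fun_eq_iff)

lemma card_le_half_C3:
  assumes A: "A \<subseteq> C3 L d" and disj: "\<And>\<chi>. \<chi> \<in> A \<Longrightarrow> recolor (torus_verts L d) \<chi> \<notin> A"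
  shows "2 * card A \<le> card (C3 L d)"
proof -
  let ?r = "recolor (torus_verts L d)"
  have fA: "finite A" using A finite_C3 finite_subset by blast
  have "inj_on ?r A" by (rule inj_on_inverseI[where g = ?r]) (use A recolor_recolor in blast)
  hence "card (?r ` A) = card A" by (rule card_image)
  moreover have "card (A \<union> ?r ` A) = card A + card (?r ` A)"
    using fA disj by (intro card_Un_disjoint) auto
  moreover have "card (A \<union> ?r ` A) \<le> card (C3 L d)"
    using A recolor_C3 by (intro card_mono finite_C3) auto
  ultimately show ?thesis by simp
qed

lemma P3_nonzero_update:
  assumes "\<chi> \<in> C3 L d" "\<chi>' \<in> C3 L d" "P3 L d \<chi> \<chi>' \<noteq> 0" "\<chi> \<noteq> \<chi>'"
  obtains v where "v \<in> torus_verts L d" "\<chi> v \<noteq> \<chi>' v" "\<chi>' = \<chi>(v := \<chi>' v)"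
proof -
  have "num_diff (torus_verts L d) \<chi> \<chi>' = 1"
    using assms(3,4) by (simp add: P3_def P3_off_def split: if_splits)
  thus ?thesis using num_diff_1_obtain[OF _ C3_PiE[OF assms(1)] C3_PiE[OF assms(2)]] that by blast
qed

text \<open>The 4-cycle is the square with vertices \<open>00, 10, 11, 01\<close>; bits \<open>2i\<close> and \<open>2i + 1\<close> encode the
  \<open>i\<close>-th coordinate, so that \<open>T_{4,d}\<close> becomes the hypercube of dimension \<open>2d\<close>.\<close>

definition bit_code :: "bool \<Rightarrow> bool \<Rightarrow> nat" where
  "bit_code a b = (if a then (if b then 2 else 1) else (if b then 3 else 0))"

definition cube_vert :: "nat \<Rightarrow> nat set \<Rightarrow> nat \<Rightarrow> nat" where
  "cube_vert d X = (\<lambda>i\<in>{..<d}. bit_code (2 * i \<in> X) (2 * i + 1 \<in> X))"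

lemma bit_code_lt: "bit_code a b < 4"
  by (simp add: bit_code_def)

lemma bit_code_inj: "bit_code a b = bit_code a' b' \<longleftrightarrow> a = a' \<and> b = b'"
  by (simp add: bit_code_def)

lemma bit_code_adj:
  "([bit_code a b = bit_code a' b' + 1] (mod 4) \<or> [bit_code a' b' = bit_code a b + 1] (mod 4))
    \<longleftrightarrow> (a \<noteq> a') \<noteq> (b \<noteq> b')"
  by (simp add: bit_code_def Cong.cong_def)

lemma cube_vert_in: "cube_vert d X \<in> torus_verts 4 d"
  by (simp add: cube_vert_def torus_verts_def bit_code_lt)

lemma cube_vert_surj:
  assumes "v \<in> torus_verts 4 d"
  shows "v \<in> cube_vert d ` Pow {..<2 * d}"
proof
  \<comment> \<open>Inverts \<open>bit_code\<close>: the bit \<open>2 * i\<close> is set for the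
    values 1 and 2, the bit \<open>2 * i + 1\<close> for 2 and 3.\<close>
  let ?X = "{k. k < 2 * d \<and> (if even k then v (k div 2) \<in> {1, 2} else v (k div 2) \<in> {2, 3})}"
  show "?X \<in> Pow {..<2 * d}" by auto
  show "v = cube_vert d ?X"
  proof
    fix i
    show "v i = cube_vert d ?X i"
    proof (cases "i < d")
      case True
      hence "v i < 4" using assms by (auto simp: torus_verts_def)
      hence "v i = 0 \<or> v i = 1 \<or> v i = 2 \<or> v i = 3" by linarith
      thus ?thesis using True by (auto simp: cube_vert_def bit_code_def)
    next
      case False
      thus ?thesis using assms by (auto simp: cube_vert_def torus_verts_def PiE_iff extensional_def)
    qed
  qed
qed

lemma cube_vert_eq_iff:
  "cube_vert d X i = cube_vert d Y i \<longleftrightarrow>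
    (i < d \<longrightarrow> (2 * i \<in> X \<longleftrightarrow> 2 * i \<in> Y) \<and> (2 * i + 1 \<in> X \<longleftrightarrow> 2 * i + 1 \<in> Y))"
  by (simp add: cube_vert_def bit_code_inj)

lemma cube_vert_inj: "inj_on (cube_vert d) (Pow {..<2 * d})"
proof (rule inj_onI)
  fix X Y assume X: "X \<in> Pow {..<2 * d}" and Y: "Y \<in> Pow {..<2 * d}" and eq: "cube_vert d X
  = cube_vert d Y"
  have "k \<in> X \<longleftrightarrow> k \<in> Y" if k: "k < 2 * d" for k
  proof -
    have "k = 2 * (k div 2) \<or> k = 2 * (k div 2) + 1" by presburger
    moreover have "k div 2 < d" using k by simp
    ultimately show ?thesis
      using fun_cong[OF eq, of "k div 2"] unfolding cube_vert_eq_iff by metis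
  qed
  thus "X = Y" using X Y by blast
qed

lemma cube_vert_adj:
  assumes "k < 2 * d"
  shows "torus_adj 4 d (cube_vert d X) (cube_vert d (flip k X))"
proof -
  let ?i = "k div 2"
  have i: "?i < d" using assms by simp
  have mem: "l \<in> flip k X \<longleftrightarrow> (l \<in> X) \<noteq> (l = k)" for l by (auto simp: flip_def)
  have k: "2 * ?i = k \<or> 2 * ?i + 1 = k" by presburger
  have "{j. j < d \<and> cube_vert d X j \<noteq> cube_vert d (flip k X) j} = {?i}"
    using i k unfolding cube_vert_eq_iff mem by auto
  moreover have "[cube_vert d X ?i = cube_vert d (flip k X) ?i + 1] (mod 4) \<or>
      [cube_vert d (flip k X) ?i = cube_vert d X ?i + 1] (mod 4)"
  proof -
    have "(2 * ?i = k) \<noteq> (2 * ?i + 1 = k)" by presburger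
    thus ?thesis using i unfolding cube_vert_def
        by (simp only: restrict_apply' lessThan_iff bit_code_adj mem) blast
  qed
  ultimately show ?thesis using i cube_vert_in unfolding torus_adj_def by blast
qed

text \<open>The converse of \<open>cube_vert_adj\<close>, needed to check that colorings defined on
  the cube are proper on the torus.\<close>

lemma torus_adj_cube_vert:
  assumes X: "X \<subseteq> {..<2 * d}" and Y: "Y \<subseteq> {..<2 * d}"
    and adj: "torus_adj 4 d (cube_vert d X) (cube_vert d Y)"
  shows "\<exists>k<2 * d. Y = flip k X"
proof -
  obtain i where i: "i < d" "{j. j < d \<and> cube_vert d X j \<noteq> cube_vert d Y j} = {i}"
    and cong: "[cube_vert d X i = cube_vert d Y i + 1] (mod 4) \<or> [cube_vert d Y i
        = cube_vert d X i + 1] (mod 4)"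
    using adj unfolding torus_adj_def by blast
  have at_i: "((2 * i \<in> X) \<noteq> (2 * i \<in> Y)) \<noteq> ((2 * i + 1 \<in> X) \<noteq> (2 * i + 1 \<in> Y))"
    using cong i(1) unfolding cube_vert_def
    by (simp only: restrict_apply' lessThan_iff bit_code_adj not_False_eq_True)
  \<comment> \<open>By \<open>at_i\<close> exactly one of the two bits of coordinate
    \<open>i\<close> differs; \<open>k\<close> is that bit.\<close>
  define k where "k = (if (2 * i \<in> X) \<noteq> (2 * i \<in> Y) then 2 * i else 2 * i + 1)"
  have "l \<in> Y \<longleftrightarrow> l \<in> flip k X" if l: "l < 2 * d" for l
  proof -
    have mem: "l \<in> flip k X \<longleftrightarrow> (l \<in> X) \<noteq> (l = k)" by (auto simp: flip_def)
    have l2: "l = 2 * (l div 2) \<or> l = 2 * (l div 2) + 1" by presburger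
    show ?thesis
    proof (cases "l div 2 = i")
      case True
      hence "l = 2 * i \<or> l = 2 * i + 1" using l2 by simp
      thus ?thesis using at_i by (auto simp: flip_def k_def)
    next
      case False
      have "l div 2 < d" using l by simp
      hence "cube_vert d X (l div 2) = cube_vert d Y (l div 2)" using i(2) False by blast
      hence "l \<in> X \<longleftrightarrow> l \<in> Y" using l2 \<open>l div 2 < d\<close> unfolding cube_vert_eq_iff by metis
      moreover have "l \<noteq> k" using False by (auto simp: k_def)
      ultimately show ?thesis unfolding mem by simp
    qed
  qed
  moreover have k: "k < 2 * d" using i(1) by (auto simp: k_def)
  ultimately have "Y = flip k X" using Y flip_subset[OF X k] by blast
  thus ?thesis using k by blast
qed

lemma C3_cube_proper:
  assumes "\<chi> \<in> C3 4 d"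
  shows "cube_proper (2 * d) (\<chi> \<circ> cube_vert d)"
  unfolding cube_proper_def comp_apply
proof (intro allI impI conjI)
  fix X k assume "k < 2 * d"
  thus "\<chi> (cube_vert d (flip k X)) \<noteq> \<chi> (cube_vert d X)"
    using C3_D(3)[OF assms cube_vert_adj[of k d X]] by simp
qed (rule C3_D(1)[OF assms cube_vert_in])

lemma C3_cube_inj:
  assumes "\<chi> \<in> C3 4 d" "\<chi>' \<in> C3 4 d"
    and eq: "\<And>X. X \<subseteq> {..<2 * d} \<Longrightarrow> (\<chi> \<circ> cube_vert d) X = (\<chi>' \<circ> cube_vert d) X"
  shows "\<chi> = \<chi>'"
proof
  fix v show "\<chi> v = \<chi>' v"
  proof (cases "v \<in> torus_verts 4 d")
    case True
    then obtain X where "X \<subseteq> {..<2 * d}" "v = cube_vert d X" using cube_vert_surj by blast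
    thus ?thesis using eq[of X] by simp
  next
    case False
    thus ?thesis using C3_D(2) assms(1,2) by metis
  qed
qed

section \<open>The majority phase of type {0} and its boundary\<close>

definition zero_phase :: "nat \<Rightarrow> ((nat \<Rightarrow> nat) \<Rightarrow> nat) set" where
  "zero_phase d = {\<chi> \<in> C3 4 d. card (even_verts (2 * d)) < 2 * card (zero_set (2
  * d) (\<chi> \<circ> cube_vert d))}"

definition zero_phase_boundary :: "nat \<Rightarrow> ((nat \<Rightarrow> nat) \<Rightarrow> nat) set" where
  "zero_phase_boundary d = {\<chi> \<in> zero_phase d.
     2 * card (zero_set (2 * d) (\<chi> \<circ> cube_vert d)) \<le> card (even_verts (2 * d)) + 2 * (2 * d)}"

lemma finite_zero_set [simp]: "finite (zero_set n g)"
  by (simp add: zero_set_def)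

text \<open>Exchanging 0 and 1 turns type \<open>{0}\<close> into type \<open>{1}\<close>, and two
  disjoint sets cannot both contain more than half of the even vertices.\<close>

lemma zero_phase_half: "2 * card (zero_phase d) \<le> card (C3 4 d)"
proof (rule card_le_half_C3)
  show "zero_phase d \<subseteq> C3 4 d" by (auto simp: zero_phase_def)
  fix \<chi> assume \<chi>: "\<chi> \<in> zero_phase d"
  let ?\<chi>' = "recolor (torus_verts 4 d) \<chi>" and ?n = "2 * d"
  show "?\<chi>' \<notin> zero_phase d"
  proof
    assume \<chi>': "?\<chi>' \<in> zero_phase d"
    have "nbr_colors ?n (?\<chi>' \<circ> cube_vert d) v = swap01 ` nbr_colors ?n (\<chi> \<circ> cube_vert d) v" for v
      by (simp add: nbr_colors_def recolor_def cube_vert_in image_image)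
    hence "zero_set ?n (\<chi> \<circ> cube_vert d) \<inter> zero_set ?n (?\<chi>' \<circ> cube_vert d) = {}"
      by (auto simp: zero_set_def swap01_def)
    hence "card (zero_set ?n (\<chi> \<circ> cube_vert d)) + card (zero_set ?n (?\<chi>' \<circ> cube_vert d))
        = card (zero_set ?n (\<chi> \<circ> cube_vert d) \<union> zero_set ?n (?\<chi>' \<circ> cube_vert d))"
      by (simp add: card_Un_disjoint)
    also have "\<dots> \<le> card (even_verts ?n)" by (intro card_mono) (auto simp: zero_set_def)
    finally show False using \<chi> \<chi>' by (simp add: zero_phase_def)
  qed
qed

text \<open>Recoloring one vertex affects only the types of its \<open>2 * d\<close> neighbors, so
  the zero set loses at most \<open>2 * d\<close> elements in a step; hence the width of
  \<open>zero_phase_boundary\<close>.\<close>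

lemma zero_phase_exits:
  assumes \<chi>: "\<chi> \<in> zero_phase d - zero_phase_boundary d" and \<chi>': "\<chi>' \<in> C3 4 d - zero_phase d"
  shows "P3 4 d \<chi> \<chi>' = 0"
proof (rule ccontr)
  assume ne: "P3 4 d \<chi> \<chi>' \<noteq> 0"
  have "\<chi> \<in> C3 4 d" "\<chi>' \<in> C3 4 d" "\<chi> \<noteq> \<chi>'" using \<chi> \<chi>' by (auto simp: zero_phase_def)
  then obtain v where v: "v \<in> torus_verts 4 d" "\<chi>' = \<chi>(v := \<chi>' v)"
    using P3_nonzero_update ne by metis
  obtain X where X: "X \<subseteq> {..<2 * d}" "v = cube_vert d X" using cube_vert_surj[OF v(1)] by blast
  let ?n = "2 * d" and ?g = "\<chi> \<circ> cube_vert d" and ?g' = "\<chi>' \<circ> cube_vert d"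
  have same: "?g Y = ?g' Y" if "Y \<subseteq> {..<?n}" "Y \<noteq> X" for Y
  proof -
    have "cube_vert d Y \<noteq> v" using inj_onD[OF cube_vert_inj, of d Y X] that X by auto
    thus ?thesis using fun_cong[OF v(2), of "cube_vert d Y"] by simp
  qed
  have "zero_set ?n ?g \<subseteq> zero_set ?n ?g' \<union> (\<lambda>k. flip k X) ` {..<?n}"
  proof
    fix u assume u: "u \<in> zero_set ?n ?g"
    show "u \<in> zero_set ?n ?g' \<union> (\<lambda>k. flip k X) ` {..<?n}"
    proof (cases "\<exists>k<?n. flip k u = X")
      case True
      then obtain k where "k < ?n" "u = flip k X" by auto
      thus ?thesis by blast
    next
      case False
      have "u \<subseteq> {..<?n}" using u by (simp add: zero_set_def even_verts_def)
      hence "nbr_colors ?n ?g u = nbr_colors ?n ?g' u"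
        unfolding nbr_colors_def using False by (intro image_cong refl same flip_subset) auto
      thus ?thesis using u by (simp add: zero_set_def)
    qed
  qed
  hence "card (zero_set ?n ?g) \<le> card (zero_set ?n ?g' \<union> (\<lambda>k. flip k X) ` {..<?n})"
    by (intro card_mono) auto
  moreover have "card (zero_set ?n ?g' \<union> (\<lambda>k. flip k X) ` {..<?n})
      \<le> card (zero_set ?n ?g') + card ((\<lambda>k. flip k X) ` {..<?n})" by (rule card_Un_le)
  moreover have "card ((\<lambda>k. flip k X) ` {..<?n}) \<le> ?n"
      using card_image_le[of "{..<?n}"] by fastforce
  ultimately have "card (zero_set ?n ?g) \<le> card (zero_set ?n ?g') + ?n" by linarith
  thus False using \<chi> \<chi>' by (auto simp: zero_phase_def zero_phase_boundary_def)
qed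

lemma card_zero_phase_ge:
  assumes d: "d > 0"
  shows "2 ^ card (even_verts (2 * d)) \<le> card (zero_phase d)"
proof -
  let ?n = "2 * d" and ?E = "even_verts (2 * d)"
  let ?inv = "inv_into (Pow {..<?n}) (cube_vert d)"
  \<comment> \<open>\<open>G\<close> is the set of even vertices colored 1; the other even vertices
    get 2. As all odd vertices get 0, every even vertex has type \<open>{0}\<close> whatever
    \<open>G\<close> is.\<close>
  define \<chi> where "\<chi> G = (\<lambda>v\<in>torus_verts 4 d. let X = ?inv v in
    if X \<notin> ?E then 0 else if X \<in> G then 1 else 2 :: nat)" for G
  have val: "\<chi> G (cube_vert d X) = (if X \<notin> ?E then 0 else if X \<in> G then 1 else 2)"
      if "X \<subseteq> {..<?n}" for G X
    using that cube_vert_in[of d X] inv_into_f_f[OF cube_vert_inj, of X d]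
    by (simp add: \<chi>_def Let_def)
  have par: "flip k X \<in> ?E \<longleftrightarrow> X \<notin> ?E" if "X \<subseteq> {..<?n}" "k < ?n" for X k
    using flip_odd[of X ?n k] flip_even[of X ?n k] that
    by (cases "X \<in> ?E") (auto simp: even_verts_def odd_verts_def)
  have C3: "\<chi> G \<in> C3 4 d" for G
  proof (rule C3_I)
    fix u v assume "u \<in> torus_verts 4 d" "v \<in> torus_verts 4 d" and adj: "torus_adj 4 d u v"
    then obtain X Y where XY: "X \<subseteq> {..<?n}" "Y \<subseteq> {..<?n}" "u = cube_vert d X" "v = cube_vert d Y"
      using cube_vert_surj[of u d] cube_vert_surj[of v d] by (auto simp: image_iff)
    obtain k where "k < ?n" "Y = flip k X"
      using torus_adj_cube_vert[OF XY(1,2)] adj XY(3,4) by auto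
    hence "Y \<in> ?E \<longleftrightarrow> X \<notin> ?E" using par XY by simp
    thus "\<chi> G u \<noteq> \<chi> G v" unfolding XY(3,4) val[OF XY(1)] val[OF XY(2)] by auto
  qed (auto simp: \<chi>_def Let_def)
  have "zero_set ?n (\<chi> G \<circ> cube_vert d) = ?E" for G
  proof -
    have "nbr_colors ?n (\<chi> G \<circ> cube_vert d) v = {0}" if v: "v \<in> ?E" for v
    proof -
      have "(\<chi> G \<circ> cube_vert d) (flip j v) = 0" if "j < ?n" for j
        using val[OF flip_subset[OF even_verts_subset[OF v] that]] par[OF even_verts_subset[OF v]
        that] v by simp
      thus ?thesis unfolding nbr_colors_def using d by (auto simp: image_iff intro!: exI[of _ 0])
    qed
    thus ?thesis by (auto simp: zero_set_def)
  qed
  moreover have "card ?E > 0" using card_parity_verts(1)[of ?n] d by simp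
  ultimately have phase: "\<chi> G \<in> zero_phase d" for G using C3 by (simp add: zero_phase_def)
  have "inj_on \<chi> (Pow ?E)"
  proof (rule inj_onI)
    fix G H assume G: "G \<in> Pow ?E" and H: "H \<in> Pow ?E" and eq: "\<chi> G = \<chi> H"
    have "X \<in> G \<longleftrightarrow> X \<in> H" if X: "X \<in> ?E" for X
      using fun_cong[OF eq, of "cube_vert d X"] X unfolding val[OF even_verts_subset[OF X]]
      by (auto split: if_splits)
    thus "G = H" using G H by blast
  qed
  moreover have "\<chi> ` Pow ?E \<subseteq> zero_phase d" using phase by blast
  moreover have "finite (zero_phase d)"
    by (rule finite_subset[OF _ finite_C3]) (auto simp: zero_phase_def)
  ultimately have "card (Pow ?E) \<le> card (zero_phase d)" by (rule card_inj_on_le)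
  thus ?thesis by (simp add: card_Pow)
qed

text \<open>\<open>E\<close> is the number of even vertices for \<open>n = 2 * d\<close>. The phase
  exceeds its boundary by a factor of at least \<open>exp (E / (40 * real d))\<close>; the last
  assumption leaves room in it for the claimed time and the factor 10 of
  \<open>mixing_time_ge\<close>.\<close>

lemma mixing_time_4_ge:
  assumes n: "2 * d \<ge> 440" "ln (real (2 * d)) / real (2 * d) \<le> 1 / 40"
    and E: "E = (4::real) ^ d / 2" "4 * real (2 * d) \<le> E" "4 + E / (8 * real d ^ 4)
        \<le> E / (40 * real d)"
  shows "ereal (exp (E / (8 * real d ^ 4))) \<le> ereal_of_enat (mixing_time (C3 4 d) (P3 4 d))"
proof -
  interpret symmetric_chain "C3 4 d" "P3 4 d" by (rule P3_symmetric_chain)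
  let ?A = "zero_phase d" and ?B = "zero_phase_boundary d" and ?K = "exp (E / (8 * real d ^ 4))"
  have d: "d > 0" using n(1) by simp
  have "card (even_verts (2 * d)) = 2 ^ (2 * d - 1)"
      using card_parity_verts(1)[of "2 * d"] d by simp
  moreover have "(4::real) ^ d = 2 * 2 ^ (2 * d - 1)"
    using d power_mult[of "2::real" 2 d] by (simp add: power_eq_if)
  ultimately have cE: "real (card (even_verts (2 * d))) = E" using E(1) by simp
  have fB: "finite ?B"
    by (rule finite_subset[OF _ finite_C3]) (auto simp: zero_phase_def zero_phase_boundary_def)
  have B: "real (card ?B) \<le> exp (E * ln 2 - E / (40 * real d))"
  proof (cases "?B = {}")
    case False
    have "ln (real (card ?B)) \<le> real (card (even_verts (2 * d))) * ln 2
        - real (card (even_verts (2 * d))) / (20 * real (2 * d))"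
    proof (rule ln_card_balanced_le[OF fB False n, where c = "\<lambda>\<chi>. \<chi> \<circ> cube_vert d"])
      show "4 * (2 * d) \<le> card (even_verts (2 * d))" using E(2) cE by linarith
    qed (auto simp: zero_phase_def zero_phase_boundary_def intro: C3_cube_proper C3_cube_inj)
    hence "ln (real (card ?B)) \<le> E * ln 2 - E / (40 * real d)" by (simp add: cE)
    hence "exp (ln (real (card ?B))) \<le> exp (E * ln 2 - E / (40 * real d))" by simp
    thus ?thesis using False fB by (simp add: card_gt_0_iff)
  qed simp
  have "real (2 ^ card (even_verts (2 * d))) \<le> real (card ?A)"
    using card_zero_phase_ge[OF d] by (rule of_nat_mono)
  hence A: "exp (E * ln 2) \<le> real (card ?A)"
    by (simp add: exp_of_nat_mult flip: cE)
  show ?thesis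
  proof (rule mixing_time_ge[OF _ _ zero_phase_half _ zero_phase_exits])
    show "?A \<subseteq> C3 4 d" "?B \<subseteq> ?A" by (auto simp: zero_phase_def zero_phase_boundary_def)
    have "real (card ?A) > 0" using A by (smt (verit) exp_gt_zero)
    thus "?A \<noteq> {}" by auto
    have "E \<ge> 0" unfolding E(1) by simp
    hence "1 \<le> ?K" by simp
    moreover have "10 * (x + 1) \<le> 24 * x" if "1 \<le> x" for x :: real using that by simp
    ultimately have "10 * (?K + 1) \<le> 24 * ?K" by blast
    also have "\<dots> \<le> exp 4 * ?K" using exp_4_ge by (intro mult_right_mono) auto
    also have "\<dots> = exp (4 + E / (8 * real d ^ 4))" by (simp add: exp_add)
    also have "\<dots> \<le> exp (E / (40 * real d))" using E(3) by simp
    finally have "10 * (?K + 1) * real (card ?B)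
        \<le> exp (E / (40 * real d)) * exp (E * ln 2 - E / (40 * real d))"
      by (intro mult_mono B) auto
    also have "\<dots> = exp (E * ln 2)" by (simp flip: exp_add)
    also note A
    finally show "10 * (?K + 1) * real (card ?B) \<le> real (card ?A)" .
  qed
qed

section \<open>The torus with side at least 6\<close>

text \<open>The integer lift of a change of color, meaningful for distinct colors below 3.\<close>

definition color_step :: "nat \<Rightarrow> nat \<Rightarrow> int" where
  "color_step a b = (if b mod 3 = (a + 1) mod 3 then 1 else - 1)"

definition line_point :: "nat \<Rightarrow> nat \<Rightarrow> nat \<Rightarrow> nat" where
  "line_point d k = (\<lambda>i\<in>{..<d}. if i = 0 then k else 0)"

text \<open>Taken along the closed line in direction 0 through the origin; the value is three times
  the number of turns around the color cycle 0, 1, 2.\<close>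

definition winding :: "nat \<Rightarrow> nat \<Rightarrow> ((nat \<Rightarrow> nat) \<Rightarrow> nat) \<Rightarrow> int" where
  "winding L d \<chi> = (\<Sum>k<L. color_step (\<chi> (line_point d k)) (\<chi> (line_point d (Suc k mod L))))"

lemma color_step_swap:
  assumes "a < 3" "b < 3" "a \<noteq> b"
  shows "color_step b a = - color_step a b" "color_step (swap01 a) (swap01 b) = - color_step a b"
proof -
  have "a = 0 \<or> a = 1 \<or> a = 2" "b = 0 \<or> b = 1 \<or> b = 2" using assms by auto
  thus "color_step b a = - color_step a b" "color_step (swap01 a) (swap01 b) = - color_step a b"
    using assms(3) by (elim disjE; simp add: color_step_def swap01_def)+
qed

lemma line_point_in: "0 < L \<Longrightarrow> k < L \<Longrightarrow> line_point d k \<in> torus_verts L d"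
  by (auto simp: line_point_def torus_verts_def)

lemma line_point_adj:
  assumes "d > 0" "L \<ge> 2" "k < L"
  shows "torus_adj L d (line_point d k) (line_point d (Suc k mod L))"
proof -
  have "Suc k mod L \<noteq> k" using assms by (cases "Suc k = L") auto
  hence "{j. j < d \<and> line_point d k j \<noteq> line_point d (Suc k mod L) j} = {0}"
    using assms(1) by (auto simp: line_point_def)
  moreover have "[line_point d (Suc k mod L) 0 = line_point d k 0 + 1] (mod L)"
    using assms(1) by (simp add: line_point_def Cong.cong_def)
  moreover have "line_point d k \<in> torus_verts L d" "line_point d (Suc k mod L) \<in> torus_verts L d"
    using assms by (auto intro!: line_point_in)
  ultimately show ?thesis using assms(1) unfolding torus_adj_def by blast
qed

lemma line_point_inj:
  assumes "d > 0" "line_point d k = line_point d l"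
  shows "k = l"
proof -
  have "line_point d k 0 = line_point d l 0" using assms(2) by simp
  thus ?thesis using assms(1) by (simp add: line_point_def)
qed

text \<open>Exchanging two colors reverses the cyclic order of the three.\<close>

lemma winding_recolor:
  assumes \<chi>: "\<chi> \<in> C3 L d" and d: "d > 0" and L: "L \<ge> 2"
  shows "winding L d (recolor (torus_verts L d) \<chi>) = - winding L d \<chi>"
proof -
  have "color_step (recolor (torus_verts L d) \<chi> (line_point d k))
        (recolor (torus_verts L d) \<chi> (line_point d (Suc k mod L)))
      = - color_step (\<chi> (line_point d k)) (\<chi> (line_point d (Suc k mod L)))" if k: "k < L" for k
  proof -
    have "line_point d k \<in> torus_verts L d" "line_point d (Suc k mod L) \<in> torus_verts L d"
      using k by (auto intro!: line_point_in)
    moreover from this have "\<chi> (line_point d k) < 3" "\<chi> (line_point d (Suc k mod L)) < 3"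
      using C3_D(1)[OF \<chi>] by auto
    moreover have "\<chi> (line_point d k) \<noteq> \<chi> (line_point d (Suc k mod L))"
      using C3_D(3)[OF \<chi> line_point_adj[OF d L k]] .
    ultimately show ?thesis by (simp add: recolor_def color_step_swap(2))
  qed
  thus ?thesis unfolding winding_def by (simp add: sum_negf)
qed

text \<open>A vertex can only change its color while all its neighbors share the third color; on the
  line, the two steps at that vertex then cancel, before and after the change.\<close>

lemma winding_update:
  assumes \<chi>: "\<chi> \<in> C3 L d" and \<chi>': "\<chi>' \<in> C3 L d" and d: "d > 0" and L: "L \<ge> 3"
    and v: "\<chi> v \<noteq> \<chi>' v" "\<chi>' = \<chi>(v := \<chi>' v)"
  shows "winding L d \<chi>' = winding L d \<chi>"
proof -
  have unchanged: "\<chi>' u = \<chi> u" if "u \<noteq> v" for u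
    by (subst v(2)) (simp add: that)
  show ?thesis
  proof (cases "\<exists>k<L. v = line_point d k")
    case False
    have same: "\<chi>' (line_point d k) = \<chi> (line_point d k)" if "k < L" for k
      using False that by (intro unchanged) auto
    show ?thesis unfolding winding_def by (intro sum.cong refl) (simp add: same)
  next
    case True
    then obtain m where m: "m < L" "v = line_point d m" by blast
    \<comment> \<open>\<open>l\<close> and \<open>r\<close> are the cyclic predecessor and successor
      of \<open>m\<close>; only the steps starting at \<open>l\<close> and at \<open>m\<close>
      involve the color of \<open>v\<close>.\<close>
    define l where "l = (if m = 0 then L - 1 else m - 1)"
    define r where "r = Suc m mod L"
    have l: "l < L" "Suc l mod L = m" "l \<noteq> m" using m(1) L by (auto simp: l_def)
    have r: "r < L" "r \<noteq> m" using m(1) L by (auto simp: r_def mod_Suc)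
    have L2: "L \<ge> 2" using L by simp
    have other: "\<chi>' (line_point d k) = \<chi> (line_point d k)" if "k \<noteq> m" for k
      using line_point_inj[OF d, of k m] that m(2) by (intro unchanged) auto
    let ?t = "\<lambda>\<chi> k. color_step (\<chi> (line_point d k)) (\<chi> (line_point d (Suc k mod L)))"
    have split: "winding L d f = ?t f l + ?t f m + (\<Sum>k\<in>{..<L} - {l, m}. ?t f k)" for f
    proof -
      have "winding L d f = (\<Sum>k\<in>{..<L} - {l, m}. ?t f k) + (\<Sum>k\<in>{l, m}. ?t f k)"
        unfolding winding_def using m(1) l(1) by (intro sum.subset_diff) auto
      thus ?thesis using l(3) by simp
    qed
    have rest: "(\<Sum>k\<in>{..<L} - {l, m}. ?t \<chi>' k) = (\<Sum>k\<in>{..<L} - {l, m}. ?t \<chi> k)"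
    proof (rule sum.cong[OF refl])
      fix k assume k: "k \<in> {..<L} - {l, m}"
      have "Suc k mod L \<noteq> m"
      proof
        assume "Suc k mod L = m"
        hence "k = l" using k m(1) by (auto simp: l_def mod_Suc split: if_splits)
        thus False using k by simp
      qed
      thus "?t \<chi>' k = ?t \<chi> k" using k by (simp add: other)
    qed
    let ?a = "\<chi> (line_point d l)" and ?b = "\<chi> (line_point d r)" and ?x = "\<chi> v" and ?y = "\<chi>' v"
    have col: "?a < 3" "?b < 3" "?x < 3" "?y < 3"
      using C3_D(1)[OF \<chi>] C3_D(1)[OF \<chi>'] line_point_in[OF _ l(1)] line_point_in[OF _ r(1)]
      line_point_in[OF _ m(1)] m
      by auto
    have "?a \<noteq> ?x" "?x \<noteq> ?b"
      using C3_D(3)[OF \<chi> line_point_adj[OF d L2 l(1)]] C3_D(3)[OF \<chi> line_point_adj[OF d L2 m(1)]]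
      l(2) m(2)
      by (auto simp: r_def)
    moreover have "?a \<noteq> ?y" "?y \<noteq> ?b"
      using C3_D(3)[OF \<chi>' line_point_adj[OF d L2 l(1)]] C3_D(3)[OF \<chi>' line_point_adj[OF d L2 m(1)]]
        other[OF l(3)] other[OF r(2)] l(2) m(2) by (auto simp: r_def)
    \<comment> \<open>Both neighbors avoid the two distinct colors \<open>?x\<close> and
      \<open>?y\<close>, so they share the third one.\<close>
    ultimately have ab: "?a = ?b" and ne: "?x \<noteq> ?a" "?y \<noteq> ?a" using col v(1) by auto
    have "?t \<chi> l + ?t \<chi> m = 0"
      using color_step_swap(1)[of ?x ?a] col ne ab l(2) m(2) by (simp add: r_def)
    moreover have "?t \<chi>' l + ?t \<chi>' m = 0"
      using color_step_swap(1)[of ?y ?a] col ne ab l(2) m(2) other[OF l(3)] other[OF r(2)]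
      by (simp add: r_def)
    ultimately show ?thesis unfolding split rest by simp
  qed
qed

text \<open>Two turns 0, 1, 2, 0, 1, 2, then 0 and 1 alternately. The value of
  \<open>winding\<close> for a proper coloring is a sum of \<open>L\<close> signs and a multiple of
  3, hence a multiple of 6 for even \<open>L\<close>: two turns are the least positive
  winding.\<close>

definition spiral_color :: "nat \<Rightarrow> nat" where
  "spiral_color k = (if k < 6 then k mod 3 else k mod 2)"

text \<open>The parities of the other coordinates make every edge of the torus change the argument
  by one mod \<open>L\<close>, so that properness reduces to the cycle of length
  \<open>L\<close>.\<close>

definition spiral :: "nat \<Rightarrow> nat \<Rightarrow> (nat \<Rightarrow> nat) \<Rightarrow> nat" where
  "spiral L d = (\<lambda>v\<in>torus_verts L d. spiral_color ((v 0 + (\<Sum>i\<in>{1..<d}. v i mod 2)) mod L))"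

lemma spiral_color_step:
  assumes "even L" "L \<ge> 6" "k < L"
  shows "color_step (spiral_color k) (spiral_color (Suc k mod L))
      = (if k < 6 \<or> even k then 1 else - 1)"
    and "spiral_color k \<noteq> spiral_color (Suc k mod L)"
proof -
  have "color_step (spiral_color k) (spiral_color (Suc k mod L))
      = (if k < 6 \<or> even k then 1 else - 1)
      \<and> spiral_color k \<noteq> spiral_color (Suc k mod L)"
  proof (cases "k < 6")
    case True
    have "spiral_color 0 = 0" "spiral_color 6 = 0" by (simp_all add: spiral_color_def)
    \<comment> \<open>After 5 comes 6, or 0 if \<open>L = 6\<close>; both have color 0.\<close>
    hence next5: "spiral_color (Suc 5 mod L) = 0" using assms(2) by (cases "L = 6") auto
    have next4: "Suc k mod L = Suc k" if "k < 5" using that assms(2) by simp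
    have "k \<in> {0, 1, 2, 3, 4, 5}" using True by auto
    thus ?thesis using next4 next5 by (elim insertE) (simp_all add: spiral_color_def color_step_def)
  next
    case False
    \<comment> \<open>The line closes up at \<open>k = L - 1\<close>, which is odd and so has color
      1, while 0 has color 0.\<close>
    consider "Suc k mod L = Suc k" | "Suc k mod L = 0" "odd k"
    using assms by (cases "Suc k = L") auto
    thus ?thesis
      using False by cases (cases "even k"; simp add: spiral_color_def color_step_def mod2_eq_if)+
  qed
  thus "color_step (spiral_color k) (spiral_color (Suc k mod L))
      = (if k < 6 \<or> even k then 1 else - 1)"
    "spiral_color k \<noteq> spiral_color (Suc k mod L)" by auto
qed

lemma spiral_color_neq:
  assumes "even L" "L \<ge> 6" "[b = a + 1] (mod L)"
  shows "spiral_color (a mod L) \<noteq> spiral_color (b mod L)"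
proof -
  have "b mod L = Suc (a mod L) mod L"
      using assms(3) unfolding Cong.cong_def by (simp add: mod_Suc_eq)
  thus ?thesis using spiral_color_step(2)[OF assms(1,2), of "a mod L"] assms(2) by simp
qed

lemma cong_1_parity:
  assumes "even L" "[x = y + 1] (mod L)"
  shows "x mod 2 \<noteq> y mod (2::nat)"
proof -
  have "[x = y + 1] (mod 2)" using assms cong_dvd_modulus_nat by blast
  thus ?thesis unfolding Cong.cong_def by presburger
qed

lemma spiral_C3:
  assumes L: "even L" "L \<ge> 6" and d: "d > 0"
  shows "spiral L d \<in> C3 L d"
proof (rule C3_I)
  fix v assume "v \<in> torus_verts L d"
  thus "spiral L d v < 3" by (auto simp: spiral_def spiral_color_def intro: less_trans[of _ 2])
next
  fix u v assume uv: "u \<in> torus_verts L d" "v \<in> torus_verts L d" and adj: "torus_adj L d u v"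
  let ?s = "\<lambda>v. v 0 + (\<Sum>i\<in>{1..<d}. v i mod (2::nat))"
  obtain i where i: "i < d" "{j. j < d
  \<and> u j \<noteq> v j} = {i}" "[u i = v i + 1] (mod L) \<or> [v i = u i + 1] (mod L)"
    using adj unfolding torus_adj_def by blast
  have same: "u j = v j" if "j < d" "j \<noteq> i" for j using i(2) that by blast
  have "[?s u = ?s v + 1] (mod L) \<or> [?s v = ?s u + 1] (mod L)"
  proof (cases "i = 0")
    case True
    have "(\<Sum>i\<in>{1..<d}. u i mod 2) = (\<Sum>i\<in>{1..<d}. v i mod 2)"
      using same True by (intro sum.cong refl) auto
    hence "[u 0 = v 0 + 1] (mod L) \<Longrightarrow> [?s u = ?s v + 1] (mod L)"
      "[v 0 = u 0 + 1] (mod L) \<Longrightarrow> [?s v = ?s u + 1] (mod L)"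
      by (metis (no_types, lifting) add.commute add.left_commute cong_add_lcancel_nat)+
    thus ?thesis using i(3) True by blast
  next
    case False
    have eq: "?s w = w 0 + (w i mod 2 + (\<Sum>i\<in>{1..<d} - {i}. w i mod 2))" for w
      using False i(1) by (subst sum.remove[of _ i]) auto
    have rest: "(\<Sum>i\<in>{1..<d} - {i}. u i mod 2) = (\<Sum>i\<in>{1..<d} - {i}. v i mod 2)"
      using same by (intro sum.cong refl) auto
    have "u 0 = v 0" using same[of 0] False d by simp
    moreover have "u i mod 2 \<noteq> v i mod 2" using i(3) cong_1_parity[OF L(1)] by metis
    hence "u i mod 2 = v i mod 2 + 1 \<or> v i mod 2 = u i mod 2 + 1" by presburger
    ultimately have "?s u = ?s v + 1 \<or> ?s v = ?s u + 1" unfolding eq rest by auto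
    thus ?thesis by auto
  qed
  hence "spiral_color (?s u mod L) \<noteq> spiral_color (?s v mod L)"
    using spiral_color_neq[OF L, of "?s u" "?s v"] spiral_color_neq[OF L, of "?s v" "?s u"] by metis
  thus "spiral L d u \<noteq> spiral L d v" using uv by (simp add: spiral_def)
qed (simp add: spiral_def)

lemma spiral_winding:
  assumes L: "even L" "L \<ge> 6" and d: "d > 0"
  shows "winding L d (spiral L d) = 6"
proof -
  have val: "spiral L d (line_point d k) = spiral_color k" if "k < L" for k
    using that line_point_in[of L k d] d by (simp add: spiral_def) (simp add: line_point_def)
  have "winding L d (spiral L d) = (\<Sum>k<L. if k < 6 \<or> even k then 1 else - 1)"
    unfolding winding_def using L by (intro sum.cong refl) (simp add: val spiral_color_step(1))
  also have "\<dots> = 6"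
  proof -
    obtain m where "L = 2 * m" using L(1) by blast
    then obtain p where p: "L = 6 + 2 * p"
    using L(2) by (metis add_diff_inverse_nat diff_mult_distrib2 even_numeral evenE
    linorder_not_less mult.commute)
    \<comment> \<open>From position 6 on, an even step counts 1 and the following odd step -1, so
      two more positions change nothing.\<close>
    have "(\<Sum>k<6 + 2 * p. if k < 6 \<or> even k then 1 else - 1 :: int) = 6"
    proof (induction p)
      case 0
      show ?case by (simp add: eval_nat_numeral)
    next
      case (Suc p)
      have eq: "6 + 2 * Suc p = Suc (Suc (6 + 2 * p))" by simp
      show ?case unfolding eq sum.lessThan_Suc Suc.IH by simp
    qed
    thus ?thesis using p by simp
  qed
  finally show ?thesis .
qed

text \<open>The winding is invariant under every move, so the colorings of positive winding have no
  exits at all; \<open>K\<close> is arbitrary, which amounts to an infinite mixing time.\<close>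

lemma mixing_time_ge_6:
  assumes L: "even L" "L \<ge> 6" and d: "d > 0"
  shows "ereal K \<le> ereal_of_enat (mixing_time (C3 L d) (P3 L d))"
proof -
  interpret symmetric_chain "C3 L d" "P3 L d" by (rule P3_symmetric_chain)
  let ?A = "{\<chi> \<in> C3 L d. winding L d \<chi> > 0}"
  show ?thesis
  proof (rule mixing_time_ge[where A = ?A and B = "{}"])
    show "?A \<noteq> {}" using spiral_C3[OF L d] spiral_winding[OF L d] by force
    show "2 * card ?A \<le> card (C3 L d)"
      using winding_recolor d L by (intro card_le_half_C3) auto
    fix \<chi> \<chi>' assume \<chi>: "\<chi> \<in> ?A - {}" and \<chi>': "\<chi>' \<in> C3 L d - ?A"
    show "P3 L d \<chi> \<chi>' = 0"
    proof (rule ccontr)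
      assume "P3 L d \<chi> \<chi>' \<noteq> 0"
      then obtain v where "\<chi> v \<noteq> \<chi>' v" "\<chi>' = \<chi>(v := \<chi>' v)"
        using P3_nonzero_update[of \<chi> L d \<chi>'] \<chi> \<chi>' by blast
      hence "winding L d \<chi>' = winding L d \<chi>" using winding_update[of \<chi> L d \<chi>' v] \<chi> \<chi>' d L by auto
      thus False using \<chi> \<chi>' by auto
    qed
  qed auto
qed

section \<open>Combination of the cases L = 4 and L at least 6\<close>

theorem theorem1p1:
  "\<exists>d\<^sub>0::real. d\<^sub>0 > 0 \<and>
     (\<forall>(d::nat) (L::nat). real d \<ge> d\<^sub>0 \<and> even L \<and> L \<ge> 4 \<longrightarrow>
        ereal_of_enat (mixing_time (C3 L d) (P3 L d)) \<ge>
          ereal (exp (real L ^ (d - 1) / (real d ^ 4 * (log 2 (real L))\<^sup>2))))"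
proof -
  have "\<forall>\<^sub>F d in sequentially. ln (real (2 * d)) / real (2 * d) \<le> 1 / 40" by real_asymp
  moreover have "\<forall>\<^sub>F d in sequentially. 4 * real (2 * d) \<le> (4::real) ^ d / 2" by real_asymp
  moreover have "\<forall>\<^sub>F d in sequentially.
      4 + (4::real) ^ d / 2 / (8 * real d ^ 4) \<le> (4::real) ^ d / 2 / (40 * real d)" by real_asymp
  moreover have "\<forall>\<^sub>F d in sequentially. 2 * d \<ge> (440::nat)" by real_asymp
  ultimately have "\<forall>\<^sub>F d in sequentially. ereal (exp ((4::real) ^ d / 2 / (8 * real d ^ 4)))
      \<le> ereal_of_enat (mixing_time (C3 4 d) (P3 4 d))"
    by eventually_elim (rule mixing_time_4_ge[OF _ _ refl])
  then obtain D where D: "\<And>d. d \<ge> D \<Longrightarrow> ereal (exp ((4::real) ^ d / 2 / (8 * real d ^ 4)))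
      \<le> ereal_of_enat (mixing_time (C3 4 d) (P3 4 d))"
    unfolding eventually_sequentially by blast
  show ?thesis
  \<comment> \<open>The shift by one makes the threshold positive and excludes
    \<open>d = 0\<close>.\<close>
  proof (intro exI[of _ "real (D + 1)"] conjI allI impI)
    fix d L :: nat assume dL: "real (D + 1) \<le> real d \<and> even L \<and> 4 \<le> L"
    hence d: "d > 0" "d \<ge> D" by linarith+
    show "ereal (exp (real L ^ (d - 1) / (real d ^ 4 * (log 2 (real L))\<^sup>2)))
        \<le> ereal_of_enat (mixing_time (C3 L d) (P3 L d))"
    proof (cases "L = 4")
      case True
      \<comment> \<open>Hence the exponent is \<open>4 ^ (d - 1) / (4 * d ^ 4)\<close>, which is the
        \<open>4 ^ d / 2 / (8 * d ^ 4)\<close> of \<open>D\<close>.\<close>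
      have "log 2 (4::real) = 2" using log_pow_cancel[of "2::real" 2] by simp
      moreover have "(4::real) ^ d = 4 * 4 ^ (d - 1)" using d(1) by (cases d) auto
      ultimately show ?thesis using D[OF d(2)] True by (simp add: mult.commute)
    next
      case False
      have L: "even L" "4 \<le> L" using dL by blast+
      hence "L \<ge> 6" using False by presburger
      thus ?thesis using L(1) d(1) by (intro mixing_time_ge_6)
    qed
  qed simp
qed

end
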